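(* Let $g\in\mathbb R\setminus\{0\}$, $N\ge1$. Consider the defect algebra $\mathcal D_{\mathcal S}$ of the $gl(N)$ nonlinear Schrödinger model with defect, generated by the entries of $r(k)=\begin{pmatrix}r_+(k)&0\\0&r_-(k)\end{pmatrix}$ and $t(k)=\begin{pmatrix}0&t_+(k)\\t_-(k)&0\end{pmatrix}$, in a Fock representation with vacuum expectation values $$\langle r_\pm(k)\rangle=\rho_\pm(k)\,M\Lambda(\pm k)M^{-1},\quad\langle t_\pm(k)\rangle=\tau_\pm(k)\,M\Lambda(\pm k)M^{-1},\quad\Lambda(k)=\frac{\mathbb I_N+iak\,\mathbb E}{1+iak},$$ where $M$ is a constant unitary $N\times N$ matrix, $\mathbb E$ is diagonal with $\mathbb E^2=\mathbb I_N$, $a$ is real (or $a=\infty$, understood as a limit) and $\rho_\pm,\tau_\pm$ are scalar functions. Define $$\lambda(k)=\frac12\Big[\Big(1+\frac{1-iak}{\sqrt{1+(ak)^2}}\Big)\mathbb I_N+\Big(1-\frac{1-iak}{\sqrt{1+(ak)^2}}\Big)\mathbb E\Big],$$ $$\widetilde r_\pm(k)=\lambda(\mp k)M^{-1}r_\pm(k)M\lambda(\mp k),\qquad\widetilde t_\pm(k)=\lambda(\mp k)M^{-1}t_\pm(k)M\lambda(\mp k),$$ $$\widetilde r(k)=\begin{pmatrix}\widetilde r_+(k)&0\\0&\widetilde r_-(k)\end{pmatrix},\qquad\widetilde t(k)=\begin{pmatrix}0&\widetilde t_+(k)\\\widetilde t_-(k)&0\end{pmatrix},$$ and let $\widetilde{\mathcal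 S}_{12}(k_1,k_2)$ be the matrix, diagonal in the sign indices, equal to $\widetilde s_{12}(\xi_1k_1,\xi_2k_2)$ on the block with signs $(\xi_1,\xi_2)$, where $$\widetilde s_{12}(k_1,k_2)=\lambda_1(-k_1)\lambda_2(-k_2)\,s_{12}(k_1-k_2)\,\lambda_1(k_1)\lambda_2(k_2).$$ Then: (i) $\lambda(k)^2=\Lambda(k)$ and $\lambda(k)\lambda(-k)=\mathbb I_N$; and $\widetilde{\mathcal S}$ satisfies unitarity $\widetilde{\mathcal S}_{12}(k_1,k_2)\widetilde{\mathcal S}_{21}(k_2,k_1)=1$ and the Yang–Baxter equation $\widetilde{\mathcal S}_{12}(k_1,k_2)\widetilde{\mathcal S}_{13}(k_1,k_3)\widetilde{\mathcal S}_{23}(k_2,k_3)=\widetilde{\mathcal S}_{23}(k_2,k_3)\widetilde{\mathcal S}_{13}(k_1,k_3)\widetilde{\mathcal S}_{12}(k_1,k_2)$. (ii) $\widetilde r,\widetilde t$ satisfy the defect algebra relations with exchange matrix $\widetilde{\mathcal S}$: $$\widetilde{\mathcal S}_{12}(k_1,k_2)\widetilde t_1(k_1)\widetilde{\mathcal S}_{21}(k_2,k_1)\widetilde t_2(k_2)=\widetilde t_2(k_2)\widetilde{\mathcal S}_{12}(k_1,k_2)\widetilde t_1(k_1)\widetilde{\mathcal S}_{21}(k_2,k_1),$$ $$\widetilde{\mathcal S}_{12}(k_1,k_2)\widetilde t_1(k_1)\widetilde{\mathcal S}_{21}(k_2,k_1)\widetilde r_2(k_2)=\widetilde r_2(k_2)\widetilde{\mathcal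 S}_{12}(k_1,-k_2)\widetilde t_1(k_1)\widetilde{\mathcal S}_{21}(-k_2,k_1),$$ $$\widetilde{\mathcal S}_{12}(k_1,k_2)\widetilde r_1(k_1)\widetilde{\mathcal S}_{21}(k_2,-k_1)\widetilde r_2(k_2)=\widetilde r_2(k_2)\widetilde{\mathcal S}_{12}(k_1,-k_2)\widetilde r_1(k_1)\widetilde{\mathcal S}_{21}(-k_2,-k_1),$$ $$\widetilde t(k)\widetilde t(k)+\widetilde r(k)\widetilde r(-k)=\mathbf 1,\qquad\widetilde t(k)\widetilde r(k)+\widetilde r(k)\widetilde t(-k)=0 .$$ (iii) $\langle\widetilde r_\pm(k)\rangle=\rho_\pm(k)\mathbb I_N$ and $\langle\widetilde t_\pm(k)\rangle=\tau_\pm(k)\mathbb I_N$; in particular all off-diagonal entries of $\widetilde r_\pm(k)$ and $\widetilde t_\pm(k)$ have vanishing vacuum expectation value (are unbroken), and only the generators obtained from the $k^{-1}$ expansion of the traces $\mathrm{tr}(\widetilde r_\pm(k))$, $\mathrm{tr}(\widetilde t_\pm(k))$ are possibly broken.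
   Context: The auxiliary space is $\mathbb C^2\otimes\mathbb C^N$ with basis labelled by $(\xi,i)$, $\xi\in\{+,-\}$, $i=1,\dots,N$; $2\times2$ blocks refer to the sign index. Subscripts $1,2,3$ denote the copy of the auxiliary space on which a matrix (with entries in the algebra) acts. With $P_{12}$ the flip on $\mathbb C^N\otimes\mathbb C^N$, put $s_{12}(k)=\dfrac{k\,\mathbb I_N\otimes\mathbb I_N-ig\,P_{12}}{k+ig}$; $\mathcal S_{12}(k_1,k_2)$ is diagonal in the sign indices and equals $s_{12}(\xi_1k_1-\xi_2k_2)$ on the block with signs $(\xi_1,\xi_2)$. The defect algebra $\mathcal D_{\mathcal S}$ is the associative unital algebra generated by the entries of $r(k),t(k)$, $k\in\mathbb R$, with relations - $\mathcal S_{12}(k_1,k_2)t_1(k_1)\mathcal S_{21}(k_2,k_1)t_2(k_2)=t_2(k_2)\mathcal S_{12}(k_1,k_2)t_1(k_1)\mathcal S_{21}(k_2,k_1)$, - $\mathcal S_{12}(k_1,k_2)t_1(k_1)\mathcal S_{21}(k_2,k_1)r_2(k_2)=r_2(k_2)\mathcal S_{12}(k_1,-k_2)t_1(k_1)\mathcal S_{21}(-k_2,k_1)$, - $\mathcal S_{12}(k_1,k_2)r_1(k_1)\mathcal S_{21}(k_2,-k_1)r_2(k_2)=r_2(k_2)\mathcal S_{12}(k_1,-k_2)r_1(k_1)\mathcal S_{21}(-k_2,-k_1)$, - $t(k)t(k)+r(k)r(-k)=\mathbf 1$, $\ t(k)r(k)+r(k)t(-k)=0$. In a Fock representation with vacuum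 vector $\Omega$, $r(k)\Omega=\mathcal R(k)\Omega$ and $t(k)\Omega=\mathcal T(k)\Omega$ with numerical matrices $\mathcal R,\mathcal T$, and $\langle\cdot\rangle$ denotes the expectation value in the unit vector $\Omega$, so $\langle r(k)\rangle=\mathcal R(k)$, $\langle t(k)\rangle=\mathcal T(k)$. A generator arising as a coefficient of $k^{-n}$, $n\ge1$, in the expansion in powers of $k^{-1}$ is called unbroken if its vacuum expectation value is zero, and broken otherwise. *)

theory Defs
  imports
    "HOL-Analysis.Analysis"
    "HOL-Library.Poly_Mapping"
    "HOL-Library.Landau_Symbols"
begin

section \<open>Auxiliary space and matrix conventions\<close>

text \<open>
  The auxiliary space \<open>\<complex>\<^sup>2 \<otimes> \<complex>\<^sup>N\<close> has the index type \<open>pm \<times> 'n\<close> with \<open>N = CARD('n)\<close>.  A matrix acting on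
  a tensor product of auxiliary spaces is indexed by tuples of indices.
\<close>

datatype pm = Plus | Minus

lemma UNIV_pm: "(UNIV :: pm set) = {Plus, Minus}"
  by (auto intro: pm.exhaust)

instance pm :: finite
  by standard (simp add: UNIV_pm)

fun pm_val :: "pm \<Rightarrow> real" where
  "pm_val Plus = 1"
| "pm_val Minus = - 1"

fun pm_opp :: "pm \<Rightarrow> pm" where
  "pm_opp Plus = Minus"
| "pm_opp Minus = Plus"

definition smult_mat :: "'a::times \<Rightarrow> 'a^'m^'n \<Rightarrow> 'a^'m^'n" (infixr \<open>*\<^sub>m\<close> 75) where
  "c *\<^sub>m A = (\<chi> i j. c * A $ i $ j)"

definition unitary_mat :: "complex^'n^'n \<Rightarrow> bool" where
  "unitary_mat M \<longleftrightarrow>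
     M ** (\<chi> i j. cnj (M $ j $ i)) = mat 1 \<and> (\<chi> i j. cnj (M $ j $ i)) ** M = mat 1"

text \<open>\<open>A\<^sub>1\<close> and \<open>A\<^sub>2\<close> on two copies; \<open>B\<^sub>2\<^sub>1\<close> from \<open>B\<^sub>1\<^sub>2\<close>; and \<open>B\<^sub>1\<^sub>2\<close>, \<open>B\<^sub>1\<^sub>3\<close>, \<open>B\<^sub>2\<^sub>3\<close> on three copies.\<close>

definition on1 :: "'a::zero^('m::finite)^'m \<Rightarrow> 'a^('m \<times> 'm)^('m \<times> 'm)" where
  "on1 A = (\<chi> p q. if snd p = snd q then A $ fst p $ fst q else 0)"

definition on2 :: "'a::zero^('m::finite)^'m \<Rightarrow> 'a^('m \<times> 'm)^('m \<times> 'm)" where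
  "on2 A = (\<chi> p q. if fst p = fst q then A $ snd p $ snd q else 0)"

definition flip12 :: "'a^(('m::finite) \<times> 'm)^('m \<times> 'm) \<Rightarrow> 'a^('m \<times> 'm)^('m \<times> 'm)" where
  "flip12 B = (\<chi> p q. B $ (snd p, fst p) $ (snd q, fst q))"

definition on12 :: "'a::zero^(('m::finite) \<times> 'm)^('m \<times> 'm) \<Rightarrow> 'a^('m \<times> 'm \<times> 'm)^('m \<times> 'm \<times> 'm)" where
  "on12 B = (\<chi> p q. case (p, q) of ((a, b, c), (a', b', c')) \<Rightarrow>
      if c = c' then B $ (a, b) $ (a', b') else 0)"

definition on13 :: "'a::zero^(('m::finite) \<times> 'm)^('m \<times> 'm) \<Rightarrow> 'a^('m \<times> 'm \<times> 'm)^('m \<times> 'm \<times> 'm)" where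
  "on13 B = (\<chi> p q. case (p, q) of ((a, b, c), (a', b', c')) \<Rightarrow>
      if b = b' then B $ (a, c) $ (a', c') else 0)"

definition on23 :: "'a::zero^(('m::finite) \<times> 'm)^('m \<times> 'm) \<Rightarrow> 'a^('m \<times> 'm \<times> 'm)^('m \<times> 'm \<times> 'm)" where
  "on23 B = (\<chi> p q. case (p, q) of ((a, b, c), (a', b', c')) \<Rightarrow>
      if a = a' then B $ (b, c) $ (b', c') else 0)"

text \<open>Block matrices with respect to the sign index; \<open>offdiag_blocks f\<close> has \<open>f Plus\<close> top right.\<close>

definition diag_blocks :: "(pm \<Rightarrow> 'a::zero^('n::finite)^'n) \<Rightarrow> 'a^(pm \<times> 'n)^(pm \<times> 'n)" where
  "diag_blocks f = (\<chi> p q. if fst q = fst p then f (fst p) $ snd p $ snd q else 0)"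

definition offdiag_blocks :: "(pm \<Rightarrow> 'a::zero^('n::finite)^'n) \<Rightarrow> 'a^(pm \<times> 'n)^(pm \<times> 'n)" where
  "offdiag_blocks f = (\<chi> p q. if fst q = pm_opp (fst p) then f (fst p) $ snd p $ snd q else 0)"

definition diag_blocks2 ::
  "(pm \<Rightarrow> pm \<Rightarrow> 'a::zero^(('n::finite) \<times> 'n)^('n \<times> 'n)) \<Rightarrow>
     'a^((pm \<times> 'n) \<times> (pm \<times> 'n))^((pm \<times> 'n) \<times> (pm \<times> 'n))" where
  "diag_blocks2 f = (\<chi> p q. case (p, q) of (((x, i), (y, j)), ((x', i'), (y', j'))) \<Rightarrow>
      if x = x' \<and> y = y' then f x y $ (i, j) $ (i', j') else 0)"


section \<open>The exchange matrices\<close>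

definition flip_mat :: "complex^(('n::finite) \<times> 'n)^('n \<times> 'n)" where
  "flip_mat = (\<chi> p q. if p = (snd q, fst q) then 1 else 0)"

definition s_mat :: "real \<Rightarrow> real \<Rightarrow> complex^(('n::finite) \<times> 'n)^('n \<times> 'n)" where
  "s_mat g k = (1 / (of_real k + \<i> * of_real g)) *\<^sub>m
     (of_real k *\<^sub>m mat 1 - (\<i> * of_real g) *\<^sub>m flip_mat)"

definition S_mat ::
  "real \<Rightarrow> real \<Rightarrow> real \<Rightarrow> complex^((pm \<times> ('n::finite)) \<times> (pm \<times> 'n))^((pm \<times> 'n) \<times> (pm \<times> 'n))" where
  "S_mat g k1 k2 = diag_blocks2 (\<lambda>x y. s_mat g (pm_val x * k1 - pm_val y * k2))"

definition Lambda_real :: "complex^'n^'n \<Rightarrow> real \<Rightarrow> real \<Rightarrow> complex^'n^'n" where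
  "Lambda_real E k a = (1 / (1 + \<i> * of_real (a * k))) *\<^sub>m (mat 1 + (\<i> * of_real (a * k)) *\<^sub>m E)"

definition lambda_real :: "complex^'n^'n \<Rightarrow> real \<Rightarrow> real \<Rightarrow> complex^'n^'n" where
  "lambda_real E k a =
     (let u = (1 - \<i> * of_real (a * k)) / of_real (sqrt (1 + (a * k)\<^sup>2))
      in (1 / 2) *\<^sub>m ((1 + u) *\<^sub>m mat 1 + (1 - u) *\<^sub>m E))"

text \<open>
  The parameter \<open>a\<close> is real or infinite.  At an infinite value, a function of \<open>a\<close> means its limit, taken
  pointwise in \<open>k\<close>; as the limit of \<open>lambda_real\<close> depends on the sign of the infinity, both are allowed.
\<close>

fun at_ext :: "(real \<Rightarrow> 'b::t2_space) \<Rightarrow> ereal \<Rightarrow> 'b" where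
  "at_ext f (ereal a) = f a"
| "at_ext f PInfty = Lim at_top f"
| "at_ext f MInfty = Lim at_bot f"

definition Lambda_mat :: "ereal \<Rightarrow> complex^'n^'n \<Rightarrow> real \<Rightarrow> complex^'n^'n" where
  "Lambda_mat a E k = at_ext (Lambda_real E k) a"

definition lambda_mat :: "ereal \<Rightarrow> complex^'n^'n \<Rightarrow> real \<Rightarrow> complex^'n^'n" where
  "lambda_mat a E k = at_ext (lambda_real E k) a"

definition s_tilde ::
  "real \<Rightarrow> ereal \<Rightarrow> complex^('n::finite)^'n \<Rightarrow> real \<Rightarrow> real \<Rightarrow> complex^('n \<times> 'n)^('n \<times> 'n)" where
  "s_tilde g a E k1 k2 =
     on1 (lambda_mat a E (- k1)) ** on2 (lambda_mat a E (- k2)) ** s_mat g (k1 - k2)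
       ** on1 (lambda_mat a E k1) ** on2 (lambda_mat a E k2)"

definition S_tilde ::
  "real \<Rightarrow> ereal \<Rightarrow> complex^('n::finite)^'n \<Rightarrow> real \<Rightarrow> real \<Rightarrow>
     complex^((pm \<times> 'n) \<times> (pm \<times> 'n))^((pm \<times> 'n) \<times> (pm \<times> 'n))" where
  "S_tilde g a E k1 k2 = diag_blocks2 (\<lambda>x y. s_tilde g a E (pm_val x * k1) (pm_val y * k2))"


section \<open>The defect algebra\<close>

text \<open>
  Free unital associative algebra on the entries of \<open>r\<^sub>\<plusminus>(k)\<close> and \<open>t\<^sub>\<plusminus>(k)\<close>, \<open>k\<close> real: the monoid algebra
  over \<open>\<complex>\<close> of the monoid of words, whose product is concatenation (the additive class is the one expected
  by \<open>poly_mapping\<close>).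
\<close>

datatype 'n defect_gen = GenR pm real 'n 'n | GenT pm real 'n 'n

datatype 'a free_word = Word (letters: "'a list")

instantiation free_word :: (type) monoid_add
begin

definition zero_free_word :: "'a free_word" where
  "0 = Word []"

definition plus_free_word :: "'a free_word \<Rightarrow> 'a free_word \<Rightarrow> 'a free_word" where
  "u + v = Word (letters u @ letters v)"

instance
  by standard (simp_all add: zero_free_word_def plus_free_word_def)

end

type_synonym 'n defect_free = "'n defect_gen free_word \<Rightarrow>\<^sub>0 complex"

definition scalar :: "complex \<Rightarrow> 'n defect_free" where
  "scalar c = Poly_Mapping.single 0 c"

definition gen :: "'n defect_gen \<Rightarrow> 'n defect_free" where
  "gen x = Poly_Mapping.single (Word [x]) 1"

text \<open>Numerical matrices, regarded as matrices with entries in the algebra.\<close>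

definition num :: "complex^'i^'j \<Rightarrow> 'n defect_free^'i^'j" where
  "num A = (\<chi> i j. scalar (A $ i $ j))"

definition r_gen :: "pm \<Rightarrow> real \<Rightarrow> ('n::finite) defect_free^'n^'n" where
  "r_gen x k = (\<chi> i j. gen (GenR x k i j))"

definition t_gen :: "pm \<Rightarrow> real \<Rightarrow> ('n::finite) defect_free^'n^'n" where
  "t_gen x k = (\<chi> i j. gen (GenT x k i j))"

definition r_mat :: "real \<Rightarrow> ('n::finite) defect_free^(pm \<times> 'n)^(pm \<times> 'n)" where
  "r_mat k = diag_blocks (\<lambda>x. r_gen x k)"

definition t_mat :: "real \<Rightarrow> ('n::finite) defect_free^(pm \<times> 'n)^(pm \<times> 'n)" where
  "t_mat k = offdiag_blocks (\<lambda>x. t_gen x k)"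

definition two_sided_ideal :: "'a::ring_1 set \<Rightarrow> bool" where
  "two_sided_ideal I \<longleftrightarrow>
     0 \<in> I \<and> (\<forall>x\<in>I. \<forall>y\<in>I. x + y \<in> I) \<and> (\<forall>x\<in>I. \<forall>a. a * x \<in> I \<and> x * a \<in> I)"

definition mat_eq_mod :: "'a::ring_1 set \<Rightarrow> 'a^'i^'j \<Rightarrow> 'a^'i^'j \<Rightarrow> bool" where
  "mat_eq_mod I A B \<longleftrightarrow> (\<forall>i j. A $ i $ j - B $ i $ j \<in> I)"

text \<open>
  The defect algebra relations with exchange matrix \<open>S\<close> for \<open>r\<close>, \<open>t\<close>, holding in the quotient of the free
  algebra by \<open>I\<close>.
\<close>

definition defect_relations ::
  "('n::finite) defect_free set \<Rightarrow>
   (real \<Rightarrow> real \<Rightarrow> complex^((pm \<times> 'n) \<times> (pm \<times> 'n))^((pm \<times> 'n) \<times> (pm \<times> 'n))) \<Rightarrow>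
   (real \<Rightarrow> 'n defect_free^(pm \<times> 'n)^(pm \<times> 'n)) \<Rightarrow>
   (real \<Rightarrow> 'n defect_free^(pm \<times> 'n)^(pm \<times> 'n)) \<Rightarrow> bool" where
  "defect_relations I S r t \<longleftrightarrow>
     (let S12 = (\<lambda>k1 k2. num (S k1 k2)); S21 = (\<lambda>k2 k1. num (flip12 (S k2 k1))) in
      (\<forall>k1 k2. mat_eq_mod I
        (S12 k1 k2 ** on1 (t k1) ** S21 k2 k1 ** on2 (t k2))
        (on2 (t k2) ** S12 k1 k2 ** on1 (t k1) ** S21 k2 k1)) \<and>
      (\<forall>k1 k2. mat_eq_mod I
        (S12 k1 k2 ** on1 (t k1) ** S21 k2 k1 ** on2 (r k2))
        (on2 (r k2) ** S12 k1 (- k2) ** on1 (t k1) ** S21 (- k2) k1)) \<and>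
      (\<forall>k1 k2. mat_eq_mod I
        (S12 k1 k2 ** on1 (r k1) ** S21 k2 (- k1) ** on2 (r k2))
        (on2 (r k2) ** S12 k1 (- k2) ** on1 (r k1) ** S21 (- k2) (- k1))) \<and>
      (\<forall>k. mat_eq_mod I (t k ** t k + r k ** r (- k)) (mat 1)) \<and>
      (\<forall>k. mat_eq_mod I (t k ** r k + r k ** t (- k)) 0))"

text \<open>
  The defect algebra is the quotient of the free algebra by the two-sided ideal generated by the relations;
  equality in it is equality modulo this ideal.
\<close>

definition defect_ideal :: "real \<Rightarrow> ('n::finite) defect_free set" where
  "defect_ideal g = \<Inter> {I. two_sided_ideal I \<and> defect_relations I (S_mat g) r_mat t_mat}"

text \<open>In \<open>\<lambda>(\<mp>k) M\<^sup>-\<^sup>1 X M \<lambda>(\<mp>k)\<close>, \<open>X\<close> is \<open>r_gen x k\<close> or \<open>t_gen x k\<close>.\<close>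

definition dressed ::
  "ereal \<Rightarrow> complex^'n^'n \<Rightarrow> complex^'n^'n \<Rightarrow> pm \<Rightarrow> real \<Rightarrow> 'n defect_free^'n^'n \<Rightarrow>
     ('n::finite) defect_free^'n^'n" where
  "dressed a E M x k X =
     num (lambda_mat a E (- pm_val x * k)) ** num (matrix_inv M) ** X ** num M
       ** num (lambda_mat a E (- pm_val x * k))"

definition r_tilde_gen ::
  "ereal \<Rightarrow> complex^'n^'n \<Rightarrow> complex^'n^'n \<Rightarrow> pm \<Rightarrow> real \<Rightarrow> ('n::finite) defect_free^'n^'n" where
  "r_tilde_gen a E M x k = dressed a E M x k (r_gen x k)"

definition t_tilde_gen ::
  "ereal \<Rightarrow> complex^'n^'n \<Rightarrow> complex^'n^'n \<Rightarrow> pm \<Rightarrow> real \<Rightarrow> ('n::finite) defect_free^'n^'n" where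
  "t_tilde_gen a E M x k = dressed a E M x k (t_gen x k)"

definition r_tilde ::
  "ereal \<Rightarrow> complex^'n^'n \<Rightarrow> complex^'n^'n \<Rightarrow> real \<Rightarrow>
     ('n::finite) defect_free^(pm \<times> 'n)^(pm \<times> 'n)" where
  "r_tilde a E M k = diag_blocks (\<lambda>x. r_tilde_gen a E M x k)"

definition t_tilde ::
  "ereal \<Rightarrow> complex^'n^'n \<Rightarrow> complex^'n^'n \<Rightarrow> real \<Rightarrow>
     ('n::finite) defect_free^(pm \<times> 'n)^(pm \<times> 'n)" where
  "t_tilde a E M k = offdiag_blocks (\<lambda>x. t_tilde_gen a E M x k)"


section \<open>Fock representations, vacuum expectation values, broken generators\<close>

text \<open>
  The operators of a representation need not be bounded, so they act on a complex inner product space (in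
  practice a dense invariant domain of the Fock space); the inner product is linear in the second argument.
\<close>

locale complex_inner_space = vector_space scale
  for scale :: "complex \<Rightarrow> 'v::ab_group_add \<Rightarrow> 'v" +
  fixes ip :: "'v \<Rightarrow> 'v \<Rightarrow> complex"
  assumes ip_add: "ip u (v + w) = ip u v + ip u w"
    and ip_scale: "ip u (scale c v) = c * ip u v"
    and ip_cnj: "ip u v = cnj (ip v u)"
    and ip_pos: "v \<noteq> 0 \<Longrightarrow> Re (ip v v) > 0"

text \<open>A representation of the defect algebra is one of the free algebra that annihilates \<open>defect_ideal g\<close>.\<close>

locale fock_representation = complex_inner_space scale ip
  for scale :: "complex \<Rightarrow> 'v::ab_group_add \<Rightarrow> 'v" and ip :: "'v \<Rightarrow> 'v \<Rightarrow> complex" +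
  fixes g :: real and \<pi> :: "('n::finite) defect_free \<Rightarrow> 'v \<Rightarrow> 'v" and \<Omega> :: 'v
  assumes rep_linear: "Vector_Spaces.linear scale scale (\<pi> x)"
    and rep_add: "\<pi> (x + y) v = \<pi> x v + \<pi> y v"
    and rep_mult: "\<pi> (x * y) v = \<pi> x (\<pi> y v)"
    and rep_scalar: "\<pi> (scalar c) v = scale c v"
    and rep_ideal: "x \<in> defect_ideal g \<Longrightarrow> \<pi> x v = 0"
    and vacuum_unit: "ip \<Omega> \<Omega> = 1"
    and vacuum_r: "\<exists>R :: real \<Rightarrow> complex^(pm \<times> 'n)^(pm \<times> 'n).
                     \<forall>k p q. \<pi> (r_mat k $ p $ q) \<Omega> = scale (R k $ p $ q) \<Omega>"
    and vacuum_t: "\<exists>T :: real \<Rightarrow> complex^(pm \<times> 'n)^(pm \<times> 'n).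
                     \<forall>k p q. \<pi> (t_mat k $ p $ q) \<Omega> = scale (T k $ p $ q) \<Omega>"

definition op_vev :: "('v \<Rightarrow> 'v \<Rightarrow> complex) \<Rightarrow> 'v \<Rightarrow> ('v \<Rightarrow> 'v) \<Rightarrow> complex" where
  "op_vev ip \<Omega> A = ip \<Omega> (A \<Omega>)"

definition mat_vev ::
  "('v \<Rightarrow> 'v \<Rightarrow> complex) \<Rightarrow> ('n defect_free \<Rightarrow> 'v \<Rightarrow> 'v) \<Rightarrow> 'v \<Rightarrow> 'n defect_free^'i^'j \<Rightarrow>
     complex^'i^'j" where
  "mat_vev ip \<pi> \<Omega> X = (\<chi> i j. op_vev ip \<Omega> (\<pi> (X $ i $ j)))"

text \<open>
  \<open>X(k) \<sim> \<Sum>\<^sub>n A\<^sub>n k\<^sup>-\<^sup>n\<close> along the filter \<open>F\<close>, as an asymptotic expansion of all matrix elements in the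
  representation.  The square root in \<open>\<lambda>\<close> makes the coefficients depend on whether \<open>k\<close> tends to plus or
  minus infinity.
\<close>

definition k_inv_expansion ::
  "('v \<Rightarrow> 'v \<Rightarrow> complex) \<Rightarrow> ('n defect_free \<Rightarrow> 'v \<Rightarrow> 'v) \<Rightarrow> real filter \<Rightarrow>
     (real \<Rightarrow> 'n defect_free) \<Rightarrow> (nat \<Rightarrow> 'v \<Rightarrow> 'v) \<Rightarrow> bool" where
  "k_inv_expansion ip \<pi> F X A \<longleftrightarrow>
     (\<forall>u v m. (\<lambda>k. ip u (\<pi> (X k) v) - (\<Sum>n\<le>m. ip u (A n v) / complex_of_real k ^ n))
                \<in> o[F](\<lambda>k. 1 / complex_of_real k ^ m))"

definition generator_from ::
  "('v \<Rightarrow> 'v \<Rightarrow> complex) \<Rightarrow> ('n defect_free \<Rightarrow> 'v \<Rightarrow> 'v) \<Rightarrow> (real \<Rightarrow> 'n defect_free) \<Rightarrow>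
     ('v \<Rightarrow> 'v) \<Rightarrow> bool" where
  "generator_from ip \<pi> X G \<longleftrightarrow>
     (\<exists>F\<in>{at_top, at_bot}. \<exists>A. \<exists>n\<ge>1. k_inv_expansion ip \<pi> F X A \<and> G = A n)"

text \<open>
  The generators given by the entries of an \<open>N \<times> N\<close> matrix \<open>X\<close> of algebra elements are spanned by those of
  \<open>tr(C X)\<close> with \<open>C\<close> a traceless numerical matrix (all off-diagonal entries and all differences of diagonal
  entries) and of \<open>tr X\<close>, so that "only the traces are possibly broken" means that every generator from
  \<open>tr(C X)\<close> with \<open>C\<close> traceless is unbroken.
\<close>

definition unbroken :: "('v \<Rightarrow> 'v \<Rightarrow> complex) \<Rightarrow> 'v \<Rightarrow> ('v \<Rightarrow> 'v) \<Rightarrow> bool" where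
  "unbroken ip \<Omega> G \<longleftrightarrow> op_vev ip \<Omega> G = 0"

end

(*
  The square root lambda of Lambda turns into a gauge transformation on the doubled space: with
  G(k) = diag(M lambda(k), M lambda(-k)) one has S~_12(k1,k2) = G_1(k1)^-1 G_2(k2)^-1 S_12(k1,k2) G_1(k1) G_2(k2)
  (M drops out since M_1 M_2 commutes with the flip), r~(k) = G(k)^-1 r(k) G(-k) and
  t~(k) = G(k)^-1 t(k) G(k).  Unitarity, the Yang-Baxter equation and the defect relations are
  covariant under such a change of gauge, and all vacuum expectation values become scalar because
  lambda(-k) Lambda(k) lambda(-k) = 1.
*)
theory Submission
  imports Defs "HOL-Real_Asymp.Real_Asymp"
begin

section \<open>Entrywise matrix calculus\<close>

text \<open>Two obstacles shape the proof. The entries of \<open>r_mat\<close> and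
  \<open>t_mat\<close> do not commute, so a gauge factor passes an operator on the other site only
  because numbers are central in the free algebra. And \<open>a\<close> may be infinite, where
  \<open>lambda_mat\<close> is only a limit. For every \<open>a\<close>, however,
  \<open>lambda_mat\<close> acts as 1 on the +1 eigenspace of \<open>E\<close> and as some u(k) on
  the -1 eigenspace, where u(k)^2 is the eigenvalue of \<open>Lambda_mat\<close> and u(k) u(-k) = 1;
  these relations survive the limit, and nothing else about u is used. The three exchange relations
  are handled together by giving each generator matrix an outgoing momentum: k for \<open>t\<close>,
  -k for \<open>r\<close>. The claims on unbroken generators then rest on the uniqueness of
  asymptotic expansions.\<close>

lemma sum_UNIV_prod:
  "(\<Sum>p\<in>(UNIV :: ('a::finite \<times> 'b::finite) set). f p) = (\<Sum>x\<in>UNIV. \<Sum>y\<in>UNIV. f (x, y))"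
  by (simp add: sum.cartesian_product)

lemma matrix_mult_nth: "(A ** B) $ i $ j = (\<Sum>k\<in>UNIV. A $ i $ k * B $ k $ j)"
  by (simp add: matrix_matrix_mult_def)

lemma mult_if_zero:
  "x * (if P then y else 0) = (if P then x * y else (0::'a::mult_zero))"
  "(if P then x else 0) * y = (if P then x * y else (0::'a::mult_zero))"
  by auto

text \<open>Conjunctive Kronecker deltas are nested so that the delta rule for sums can remove one
  summation index at a time; the entrywise proofs by \<open>mult_simps\<close> rest on this.\<close>

lemma if_conj: "(if P \<and> Q then x else z) = (if P then if Q then x else z else z)"
  by auto

lemma pm_opp_eq_iff: "pm_opp x = pm_opp y \<longleftrightarrow> x = y"
  by (cases x; cases y) auto

lemma on1_nth: "on1 A $ (a, b) $ (a', b') = (if b = b' then A $ a $ a' else 0)"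
  by (simp add: on1_def)

lemma on2_nth: "on2 A $ (a, b) $ (a', b') = (if a = a' then A $ b $ b' else 0)"
  by (simp add: on2_def)

lemma on12_nth: "on12 B $ (a, b, c) $ (a', b', c') = (if c = c' then B $ (a, b) $ (a', b') else 0)"
  by (simp add: on12_def)

lemma on13_nth: "on13 B $ (a, b, c) $ (a', b', c') = (if b = b' then B $ (a, c) $ (a', c') else 0)"
  by (simp add: on13_def)

lemma on23_nth: "on23 B $ (a, b, c) $ (a', b', c') = (if a = a' then B $ (b, c) $ (b', c') else 0)"
  by (simp add: on23_def)

lemma flip12_nth: "flip12 B $ (a, b) $ (a', b') = B $ (b, a) $ (b', a')"
  by (simp add: flip12_def)

lemma diag_blocks_nth: "diag_blocks f $ (x, i) $ (y, j) = (if x = y then f x $ i $ j else 0)"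
  by (auto simp: diag_blocks_def)

lemma offdiag_blocks_nth:
  "offdiag_blocks f $ (x, i) $ (y, j) = (if y = pm_opp x then f x $ i $ j else 0)"
  by (simp add: offdiag_blocks_def)

lemma diag_blocks2_nth:
  "diag_blocks2 f $ ((x, i), (y, j)) $ ((x', i'), (y', j')) =
     (if x = x' \<and> y = y' then f x y $ (i, j) $ (i', j') else 0)"
  by (simp add: diag_blocks2_def)

lemma mat_nth: "mat c $ i $ j = (if i = j then c else 0)"
  by (simp add: mat_def)

lemma smult_mat_nth: "(c *\<^sub>m A) $ i $ j = c * A $ i $ j"
  by (simp add: smult_mat_def)

text \<open>Products of exchange matrices on three copies stay diagonal in all three signs, so the
  Yang-Baxter equation splits into one equation for \<open>s_mat\<close> per sign triple.\<close>

definition diag_blocks3 ::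
  "(pm \<Rightarrow> pm \<Rightarrow> pm \<Rightarrow> 'a::zero^(('n::finite) \<times> 'n \<times> 'n)^('n \<times> 'n \<times> 'n)) \<Rightarrow>
     'a^((pm \<times> 'n) \<times> (pm \<times> 'n) \<times> (pm \<times> 'n))^((pm \<times> 'n) \<times> (pm \<times> 'n) \<times> (pm \<times> 'n))" where
  "diag_blocks3 f = (\<chi> p q. case (p, q) of
      (((x, i), (y, j), (z, l)), ((x', i'), (y', j'), (z', l'))) \<Rightarrow>
        if x = x' \<and> y = y' \<and> z = z' then f x y z $ (i, j, l) $ (i', j', l') else 0)"

lemma diag_blocks3_nth:
  "diag_blocks3 f $ ((x, i), (y, j), (z, l)) $ ((x', i'), (y', j'), (z', l')) =
     (if x = x' \<and> y = y' \<and> z = z' then f x y z $ (i, j, l) $ (i', j', l') else 0)"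
  by (simp add: diag_blocks3_def)

lemmas mat_simps = on1_nth on2_nth on12_nth on13_nth on23_nth flip12_nth diag_blocks_nth
  offdiag_blocks_nth diag_blocks2_nth diag_blocks3_nth mat_nth smult_mat_nth matrix_mult_nth

lemma sum_if_const: "(\<Sum>y\<in>A. if P then f y else 0) = (if P then \<Sum>y\<in>A. f y else 0)"
  by simp

lemmas mult_simps = mat_simps sum_UNIV_prod mult_if_zero if_conj sum_if_const pm_opp_eq_iff

lemma on1_mult: "on1 (A ** B) = on1 A ** on1 (B :: 'a::semiring_1^'m::finite^'m)"
  by (simp add: vec_eq_iff mult_simps)

lemma on2_mult: "on2 (A ** B) = on2 A ** on2 (B :: 'a::semiring_1^'m::finite^'m)"
  by (simp add: vec_eq_iff mult_simps)

lemma flip12_mult: "flip12 (A ** B) = flip12 A ** flip12 (B :: 'a::semiring_1^('m::finite\<times>'m)^('m\<times>'m))"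
  by (simp add: vec_eq_iff mult_simps) (intro allI sum.swap)

lemma on12_mult: "on12 (A ** B) = on12 A ** on12 (B :: 'a::semiring_1^('m::finite\<times>'m)^('m\<times>'m))"
  by (simp add: vec_eq_iff mult_simps)

lemma on23_mult: "on23 (A ** B) = on23 A ** on23 (B :: 'a::semiring_1^('m::finite\<times>'m)^('m\<times>'m))"
  by (simp add: vec_eq_iff mult_simps)

lemma on13_mult: "on13 (A ** B) = on13 A ** on13 (B :: 'a::semiring_1^('m::finite\<times>'m)^('m\<times>'m))"
  by (simp add: vec_eq_iff mult_simps)

lemma diag_blocks_mult:
  "diag_blocks f ** diag_blocks g =
     diag_blocks (\<lambda>x. f x ** (g x :: 'a::semiring_1^'n::finite^'n))"
  by (simp add: vec_eq_iff mult_simps)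

lemma diag_blocks_mult_offdiag:
  "diag_blocks f ** offdiag_blocks g =
     offdiag_blocks (\<lambda>x. f x ** (g x :: 'a::semiring_1^'n::finite^'n))"
  by (auto simp: vec_eq_iff mult_simps cong: if_cong intro!: sum.neutral)

lemma offdiag_blocks_mult_diag:
  "offdiag_blocks f ** diag_blocks g =
     offdiag_blocks (\<lambda>x. f x ** (g (pm_opp x) :: 'a::semiring_1^'n::finite^'n))"
  by (simp add: vec_eq_iff mult_simps)

lemma diag_blocks2_mult:
  "diag_blocks2 f ** diag_blocks2 g =
     diag_blocks2 (\<lambda>x y. f x y ** (g x y :: 'a::semiring_1^('n::finite \<times> 'n)^('n \<times> 'n)))"
  by (simp add: vec_eq_iff mult_simps)

lemma diag_blocks3_mult:
  "diag_blocks3 f ** diag_blocks3 g =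
     diag_blocks3 (\<lambda>x y z. f x y z ** (g x y z :: 'a::semiring_1^('n::finite \<times> 'n \<times> 'n)^('n \<times> 'n \<times> 'n)))"
  by (simp add: vec_eq_iff mult_simps)

lemma on1_mat: "on1 (mat c) = mat c"
  by (auto simp: vec_eq_iff mat_simps)

lemma on2_mat: "on2 (mat c) = mat c"
  by (auto simp: vec_eq_iff mat_simps)

lemma on12_mat: "on12 (mat c) = mat c"
  by (auto simp: vec_eq_iff mat_simps)

lemma on13_mat: "on13 (mat c) = mat c"
  by (auto simp: vec_eq_iff mat_simps)

lemma diag_blocks_mat: "diag_blocks (\<lambda>x. mat c) = mat c"
  by (auto simp: vec_eq_iff mat_simps)

lemma diag_blocks2_mat: "diag_blocks2 (\<lambda>x y. mat c) = mat c"
  by (auto simp: vec_eq_iff mat_simps)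

lemma flip12_on1: "flip12 (on1 A) = on2 A"
  by (auto simp: vec_eq_iff mat_simps)

lemma flip12_on2: "flip12 (on2 A) = on1 A"
  by (auto simp: vec_eq_iff mat_simps)

lemma on1_diag_blocks: "on1 (diag_blocks f) = diag_blocks2 (\<lambda>x y. on1 (f x))"
  by (auto simp: vec_eq_iff mat_simps)

lemma on2_diag_blocks: "on2 (diag_blocks f) = diag_blocks2 (\<lambda>x y. on2 (f y))"
  by (auto simp: vec_eq_iff mat_simps)

lemma flip12_diag_blocks2: "flip12 (diag_blocks2 f) = diag_blocks2 (\<lambda>x y. flip12 (f y x))"
  by (auto simp: vec_eq_iff mat_simps)

lemma on12_diag_blocks2: "on12 (diag_blocks2 f) = diag_blocks3 (\<lambda>x y z. on12 (f x y))"
  by (auto simp: vec_eq_iff mat_simps)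

lemma on13_diag_blocks2: "on13 (diag_blocks2 f) = diag_blocks3 (\<lambda>x y z. on13 (f x z))"
  by (auto simp: vec_eq_iff mat_simps)

lemma on23_diag_blocks2: "on23 (diag_blocks2 f) = diag_blocks3 (\<lambda>x y z. on23 (f y z))"
  by (auto simp: vec_eq_iff mat_simps)

text \<open>Operators on sites 1, 2 and 3 get one canonical form each, \<open>on12 (on1 _)\<close>,
  \<open>on12 (on2 _)\<close> and \<open>on13 (on2 _)\<close>, so that gauge factors coming from
  different embeddings can cancel.\<close>

lemma on13_on1: "on13 (on1 A) = on12 (on1 A)"
  by (auto simp: vec_eq_iff mat_simps)

lemma on23_on1: "on23 (on1 A) = on12 (on2 A)"
  by (auto simp: vec_eq_iff mat_simps)

lemma on23_on2: "on23 (on2 A) = on13 (on2 A)"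
  by (auto simp: vec_eq_iff mat_simps)

text \<open>Commutation is assumed entrywise because the free algebra is not commutative: the lemma
  has to serve complex matrices as well as a numerical matrix paired with a matrix of
  generators.\<close>

lemma on1_on2_commute:
  assumes "\<And>i j x y. A $ i $ j * B $ x $ y = B $ x $ y * A $ i $ j"
  shows "on1 A ** on2 B = on2 B ** on1 (A :: 'a::semiring_1^'m::finite^'m)"
  by (simp add: vec_eq_iff mult_simps assms)

lemma on12_on3_commute:
  "on12 B ** on13 (on2 A) = on13 (on2 A) ** on12 (B :: 'a::comm_semiring_1^('m::finite \<times> 'm)^('m \<times> 'm))"
  by (simp add: vec_eq_iff mult_simps mult.commute)

lemma on13_on2_commute:
  "on13 B ** on12 (on2 A) = on12 (on2 A) ** on13 (B :: 'a::comm_semiring_1^('m::finite \<times> 'm)^('m \<times> 'm))"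
  by (simp add: vec_eq_iff mult_simps mult.commute)

lemma on23_on1_commute:
  "on23 B ** on12 (on1 A) = on12 (on1 A) ** on23 (B :: 'a::comm_semiring_1^('m::finite \<times> 'm)^('m \<times> 'm))"
  by (simp add: vec_eq_iff mult_simps mult.commute)

section \<open>The rational exchange matrix\<close>

text \<open>Matrix products become compositions of maps, so the relations among the flips on three
  sites are read off from the symmetric group on three letters.\<close>

definition perm_mat :: "('i \<Rightarrow> 'i) \<Rightarrow> complex^'i::finite^'i" where
  "perm_mat \<sigma> = (\<chi> p q. if p = \<sigma> q then 1 else 0)"

lemma perm_mat_mult: "perm_mat \<sigma> ** perm_mat \<tau> = perm_mat (\<sigma> \<circ> \<tau>)"
  by (simp add: perm_mat_def vec_eq_iff matrix_mult_nth mult_if_zero)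

lemma perm_mat_id: "perm_mat (\<lambda>x. x) = mat 1"
  by (simp add: perm_mat_def mat_def)

lemma flip_mat_eq: "flip_mat = perm_mat (\<lambda>(a, b). (b, a))"
  by (simp add: flip_mat_def perm_mat_def case_prod_unfold)

lemma flip_mat_nth: "flip_mat $ (a, b) $ (c, d) = (if a = d \<and> b = c then 1 else 0)"
  by (simp add: flip_mat_def)

lemma on12_flip: "on12 flip_mat = perm_mat (\<lambda>(a, b, c). (b, a, c))"
  by (auto simp: vec_eq_iff mat_simps perm_mat_def flip_mat_nth)

lemma on13_flip: "on13 flip_mat = perm_mat (\<lambda>(a, b, c). (c, b, a))"
  by (auto simp: vec_eq_iff mat_simps perm_mat_def flip_mat_nth)

lemma on23_flip: "on23 flip_mat = perm_mat (\<lambda>(a, b, c). (a, c, b))"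
  by (auto simp: vec_eq_iff mat_simps perm_mat_def flip_mat_nth)

lemma flip_mat_square: "flip_mat ** flip_mat = mat 1"
  by (simp add: flip_mat_eq perm_mat_mult perm_mat_id[symmetric] comp_def case_prod_unfold)

lemma flip_on1: "flip_mat ** on1 A = on2 A ** flip_mat"
  by (simp add: vec_eq_iff mult_simps flip_mat_nth mult_if_zero conj_commute)

lemma flip_on2: "flip_mat ** on2 A = on1 A ** flip_mat"
  by (simp add: vec_eq_iff mult_simps flip_mat_nth)

lemma smult_mult_left: "(c *\<^sub>m A) ** B = c *\<^sub>m (A ** (B :: 'a::semiring_1^'m^'n::finite))"
  by (simp add: vec_eq_iff smult_mat_nth matrix_mult_nth sum_distrib_left mult.assoc)

lemma smult_mult_right: "A ** (c *\<^sub>m B) = c *\<^sub>m (A ** (B :: 'a::comm_semiring_1^'m^'n::finite))"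
  by (simp add: vec_eq_iff smult_mat_nth matrix_mult_nth sum_distrib_left mult.left_commute)

lemma matrix_add_rdistrib: "(A + B) ** C = A ** C + B ** (C :: 'a::semiring_1^'m^'n::finite)"
  by (simp add: vec_eq_iff matrix_mult_nth distrib_right sum.distrib)

lemma s_mat_eq:
  "s_mat g k = (of_real k / (of_real k + \<i> * of_real g)) *\<^sub>m mat 1
     + (- (\<i> * of_real g) / (of_real k + \<i> * of_real g)) *\<^sub>m flip_mat"
  by (simp add: s_mat_def vec_eq_iff smult_mat_nth right_diff_distrib)

lemma on_affine:
  "on12 (x *\<^sub>m mat 1 + y *\<^sub>m flip_mat) = x *\<^sub>m mat 1 + y *\<^sub>m (on12 flip_mat :: complex^('n \<times> 'n \<times> 'n)^('n::finite \<times> 'n \<times> 'n))"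
  "on13 (x *\<^sub>m mat 1 + y *\<^sub>m flip_mat) = x *\<^sub>m mat 1 + y *\<^sub>m (on13 flip_mat :: complex^('n \<times> 'n \<times> 'n)^('n::finite \<times> 'n \<times> 'n))"
  "on23 (x *\<^sub>m mat 1 + y *\<^sub>m flip_mat) = x *\<^sub>m mat 1 + y *\<^sub>m (on23 flip_mat :: complex^('n \<times> 'n \<times> 'n)^('n::finite \<times> 'n \<times> 'n))"
  by (auto simp: vec_eq_iff mat_simps)

lemma flip_yang_baxter:
  fixes x1 x2 x3 y1 y2 y3 :: complex
  assumes "x1 * y2 * y3 + y1 * y2 * x3 = y1 * x2 * y3"
  shows "on12 (x1 *\<^sub>m mat 1 + y1 *\<^sub>m flip_mat) ** on13 (x2 *\<^sub>m mat 1 + y2 *\<^sub>m flip_mat)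
           ** on23 (x3 *\<^sub>m mat 1 + y3 *\<^sub>m flip_mat) =
         on23 (x3 *\<^sub>m mat 1 + y3 *\<^sub>m flip_mat) ** on13 (x2 *\<^sub>m mat 1 + y2 *\<^sub>m flip_mat)
           ** on12 (x1 *\<^sub>m mat 1 + y1 *\<^sub>m (flip_mat :: complex^('n \<times> 'n)^('n::finite \<times> 'n)))"
proof -
  let ?P = "on12 flip_mat :: complex^('n \<times> 'n \<times> 'n)^('n \<times> 'n \<times> 'n)"
  let ?Q = "on13 flip_mat :: complex^('n \<times> 'n \<times> 'n)^('n \<times> 'n \<times> 'n)"
  let ?R = "on23 flip_mat :: complex^('n \<times> 'n \<times> 'n)^('n \<times> 'n \<times> 'n)"
  have perms: "?Q ** ?R = ?P ** ?Q" "?R ** ?P = ?P ** ?Q" "?Q ** ?P = ?P ** ?R" "?R ** ?Q = ?P ** ?R"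
    "?P ** ?Q ** ?R = ?P ** ?R ** ?P"
    by (simp_all add: on12_flip on13_flip on23_flip perm_mat_mult comp_def case_prod_unfold)
  \<comment> \<open>Entries of the identity (\<open>e\<close>), the transpositions (\<open>p, q, r\<close>, and \<open>t\<close> for the triple product),
    and the two 3-cycles (\<open>c, d\<close>); only the 3-cycles need the hypothesis.\<close>
  have poly: "x3 * (x2 * (x1 * e + y1 * p) + y2 * (x1 * q + y1 * c))
      + y3 * (x2 * (x1 * r + y1 * d) + y2 * (x1 * c + y1 * t)) =
      x1 * (x2 * (x3 * e + y3 * r) + y2 * (x3 * q + y3 * d))
      + y1 * (x2 * (x3 * p + y3 * c) + y2 * (x3 * d + y3 * t))"
    (is "?l = ?r") for c d e p q r t
  proof -
    have "?l - ?r = (x1 * y2 * y3 + y1 * y2 * x3 - y1 * x2 * y3) * (c - d)"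
      by (simp add: algebra_simps)
    also have "\<dots> = 0"
      using assms by simp
    finally show ?thesis
      by (rule eq_iff_diff_eq_0[THEN iffD2])
  qed
  show ?thesis
    unfolding on_affine
    by (simp add: matrix_add_ldistrib matrix_add_rdistrib smult_mult_left smult_mult_right perms
        flip: matrix_mul_assoc) (simp add: vec_eq_iff smult_mat_nth, intro allI, rule poly)
qed

text \<open>Up to denominators all flip coefficients equal -ig, and the hypothesis of
  \<open>flip_yang_baxter\<close> says that the middle spectral parameter is the sum of the outer
  two. Hence the arguments k, k + l, l, to be read as differences of three momenta.\<close>

lemma s_mat_yang_baxter:
  "on12 (s_mat g k) ** on13 (s_mat g (k + l)) ** on23 (s_mat g l) =
     on23 (s_mat g l) ** on13 (s_mat g (k + l)) ** on12 (s_mat g k)"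
proof -
  \<comment> \<open>Both sides carry the same three denominators, so only numerators are compared
    and no denominator is cleared.\<close>
  have key: "x / c * (m / d) * (m / e) + m / c * (m / d) * (y / e) = m / c * ((x + y) / d) * (m / e)"
    for x y c d e m :: complex
    unfolding times_divide_times_eq add_divide_distrib[symmetric]
    by (simp add: distrib_left distrib_right mult_ac)
  show ?thesis
    unfolding s_mat_eq by (rule flip_yang_baxter) (simp only: of_real_add key)
qed

lemma flip12_s_mat: "flip12 (s_mat g k) = s_mat g k"
  by (simp add: s_mat_def vec_eq_iff smult_mat_nth flip12_nth mat_nth flip_mat_nth conj_commute)

text \<open>As the flip P squares to 1, (k - igP)(-k - igP) = -(k^2 + g^2) = (k + ig)(-k + ig). A
  nonzero real \<open>g\<close> keeps both denominators away from 0, also at k = 0.\<close>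

lemma s_mat_unitary:
  assumes "g \<noteq> 0"
  shows "s_mat g k ** s_mat g (- k) = mat 1"
proof -
  have "of_real k + \<i> * of_real g \<noteq> 0" "- of_real k + \<i> * of_real g \<noteq> 0"
    using assms by (auto simp: complex_eq_iff)
  then show ?thesis
    unfolding s_mat_eq
    by (simp add: matrix_add_ldistrib matrix_add_rdistrib smult_mult_left smult_mult_right flip_mat_square)
      (simp add: vec_eq_iff smult_mat_nth mat_nth, simp add: divide_simps, auto simp: algebra_simps)
qed

lemma s_mat_on1_on2: "s_mat g k ** (on1 A ** on2 A) = (on1 A ** on2 A) ** s_mat g k"
proof -
  have c: "on2 A ** on1 A = on1 A ** on2 A" by (rule on1_on2_commute[symmetric]) (rule mult.commute)
  have "flip_mat ** (on1 A ** on2 A) = on2 A ** (flip_mat ** on2 A)"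
    by (simp only: matrix_mul_assoc flip_on1)
  also have "\<dots> = (on1 A ** on2 A) ** flip_mat"
    by (simp only: flip_on2) (simp only: matrix_mul_assoc c)
  finally have "flip_mat ** (on1 A ** on2 A) = (on1 A ** on2 A) ** flip_mat" .
  then show ?thesis
    unfolding s_mat_eq
    by (simp add: matrix_add_ldistrib matrix_add_rdistrib smult_mult_left smult_mult_right)
qed

section \<open>Numerical matrices over the free algebra\<close>

lemma scalar_mult: "scalar (c * d) = scalar c * scalar d"
  by (simp add: scalar_def mult_single)

lemma scalar_add: "scalar (c + d) = scalar c + scalar d"
  by (simp add: scalar_def single_add)

lemma scalar_0 [simp]: "scalar 0 = 0"
  by (simp add: scalar_def)

lemma scalar_1 [simp]: "scalar 1 = 1"
  by (simp add: scalar_def)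

lemma scalar_sum: "scalar (sum f A) = (\<Sum>x\<in>A. scalar (f x))"
  by (induction A rule: infinite_finite_induct) (simp_all add: scalar_add)

text \<open>A scalar is supported on the empty word, the unit of the monoid of words. This
  centrality is the substitute for commutativity wherever numerical matrices meet
  generators.\<close>

lemma scalar_commute: "scalar c * x = x * scalar c"
proof (induction x rule: update_induct)
  case const
  then show ?case by simp
next
  case (update f a b)
  \<comment> \<open>The induction only updates at a key outside the support of \<open>f\<close>, so
    the update is an addition.\<close>
  then have "Poly_Mapping.update a b f = f + Poly_Mapping.single a b"
    by (intro poly_mapping_eqI) (auto simp: lookup_update lookup_add lookup_single in_keys_iff when_def)
  moreover have "scalar c * Poly_Mapping.single a b = Poly_Mapping.single a b * scalar c"
    by (simp add: scalar_def mult_single mult.commute)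
  ultimately show ?case
    using update.IH by (simp add: distrib_left distrib_right)
qed

lemma num_nth: "num A $ i $ j = scalar (A $ i $ j)"
  by (simp add: num_def)

lemma num_mult: "num (A ** B) = num A ** num (B :: complex^'i^'m::finite)"
  by (simp add: vec_eq_iff num_nth matrix_mult_nth scalar_sum scalar_mult)

lemma num_mat: "num (mat c) = mat (scalar c)"
  by (simp add: vec_eq_iff num_nth mat_nth)

lemma num_on1: "num (on1 A) = on1 (num A)"
  by (simp add: vec_eq_iff num_nth on1_nth)

lemma num_on2: "num (on2 A) = on2 (num A)"
  by (simp add: vec_eq_iff num_nth on2_nth)

lemma num_diag_blocks: "num (diag_blocks f) = diag_blocks (\<lambda>x. num (f x))"
  by (simp add: vec_eq_iff num_nth diag_blocks_nth)

lemma on2_num_on1: "on2 (num A) ** on1 X = on1 X ** on2 (num A)"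
  by (rule on1_on2_commute[symmetric]) (simp add: num_nth scalar_commute)

lemma on1_num_on2: "on1 (num A) ** on2 X = on2 X ** on1 (num A)"
  by (rule on1_on2_commute) (simp add: num_nth scalar_commute)

section \<open>Gauge transformations\<close>

definition gauged ::
  "(real \<Rightarrow> complex^'m^'m) \<Rightarrow> (real \<Rightarrow> complex^'m^'m) \<Rightarrow> (real \<Rightarrow> real \<Rightarrow> complex^('m \<times> 'm)^('m \<times> 'm)) \<Rightarrow>
     real \<Rightarrow> real \<Rightarrow> complex^('m::finite \<times> 'm)^('m \<times> 'm)" where
  "gauged H G S k1 k2 = on1 (H k1) ** on2 (H k2) ** S k1 k2 ** on1 (G k1) ** on2 (G k2)"

text \<open>With products nested to the right, a law for two adjacent factors must also apply in
  front of a further factor; this lemma and the next supply that second form.\<close>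

lemma mult_assoc_tail: "A ** B = C \<Longrightarrow> A ** (B ** X) = C ** (X :: 'a::semiring_1^'i^'m::finite)"
  by (simp add: matrix_mul_assoc)

lemma mult_cancel_tail: "A ** B = mat 1 \<Longrightarrow> A ** (B ** X) = (X :: 'a::semiring_1^'i^'m::finite)"
  by (simp add: matrix_mul_assoc)

context
  fixes G H :: "real \<Rightarrow> complex^'m^'m::finite"
    and S :: "real \<Rightarrow> real \<Rightarrow> complex^('m \<times> 'm)^('m \<times> 'm)"
  assumes GH: "\<And>k. G k ** H k = mat 1"
begin

lemma on_GH:
  "on1 (num (G k)) ** on1 (num (H k)) = mat 1"
  "on2 (num (G k)) ** on2 (num (H k)) = mat 1"
  by (simp_all add: GH on1_mat on2_mat num_mat flip: on1_mult on2_mult num_mult)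

lemmas gauge_simps = gauged_def flip12_mult flip12_on1 flip12_on2 num_mult num_on1 num_on2 on1_mult on2_mult
  matrix_mul_assoc[symmetric] on_GH on_GH[THEN mult_cancel_tail]
  on2_num_on1 on2_num_on1[THEN mult_assoc_tail]

text \<open>The momenta \<open>p1\<close>, \<open>p2\<close> are the outgoing ones, \<open>k\<close>
  for \<open>t\<close> and \<open>- k\<close> for \<open>r\<close>, so one identity covers all three
  exchange relations. Every inner \<open>G\<close> meets the \<open>H\<close> of the same site and
  momentum, after passing operators on the other site.\<close>

lemma gauged_exchange_left:
  "num (gauged H G S k1 k2) ** on1 (num (H k1) ** X ** num (G p1)) ** num (flip12 (gauged H G S k2 p1))
       ** on2 (num (H k2) ** Y ** num (G p2)) =
     on1 (num (H k1)) ** on2 (num (H k2)) **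
       (num (S k1 k2) ** on1 X ** num (flip12 (S k2 p1)) ** on2 Y) ** (on1 (num (G p1)) ** on2 (num (G p2)))"
  \<comment> \<open>Moving site-1 numbers past site 2 is allowed for \<open>Y\<close> alone; for
    arbitrary site-2 factors it would undo \<open>on2_num_on1\<close> and loop.\<close>
  by (simp add: gauge_simps on1_num_on2[of _ Y] on1_num_on2[of _ Y, THEN mult_assoc_tail])

text \<open>The outer factors are the same as in \<open>gauged_exchange_left\<close>. The difference
  of the two gauged sides is thus the ungauged difference multiplied on both sides by numerical
  matrices, which stays in an ideal.\<close>

lemma gauged_exchange_right:
  "on2 (num (H k2) ** Y ** num (G p2)) ** num (gauged H G S k1 p2) ** on1 (num (H k1) ** X ** num (G p1))
       ** num (flip12 (gauged H G S p2 p1)) =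
     on1 (num (H k1)) ** on2 (num (H k2)) **
       (on2 Y ** num (S k1 p2) ** on1 X ** num (flip12 (S p2 p1))) ** (on1 (num (G p1)) ** on2 (num (G p2)))"
  by (simp add: gauge_simps on1_num_on2[of _ Y, symmetric] on1_num_on2[of _ Y, symmetric, THEN mult_assoc_tail])

lemma gauged_unitary:
  assumes "S k1 k2 ** flip12 (S k2 k1) = mat 1"
  shows "gauged H G S k1 k2 ** flip12 (gauged H G S k2 k1) = mat 1"
proof -
  have HG: "H k ** G k = mat 1" for k
    using GH by (simp add: matrix_left_right_inverse)
  have cancel: "on1 (G k) ** on1 (H k) = mat 1" "on2 (G k) ** on2 (H k) = mat 1"
     "on1 (H k) ** on1 (G k) = mat 1" "on2 (H k) ** on2 (G k) = mat 1" for k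
    by (simp_all add: GH HG on1_mat on2_mat flip: on1_mult on2_mult)
  show ?thesis
    by (simp add: gauged_def flip12_mult flip12_on1 flip12_on2 matrix_mul_assoc[symmetric]
        cancel cancel[THEN mult_cancel_tail] mult_cancel_tail[OF assms])
qed

lemma on12_on3_GH:
  "on12 (on1 (G k)) ** on12 (on1 (H k)) = mat 1"
  "on12 (on2 (G k)) ** on12 (on2 (H k)) = mat 1"
  "on13 (on2 (G k)) ** on13 (on2 (H k)) = mat 1"
  by (simp_all add: GH on1_mat on2_mat on12_mat on13_mat flip: on12_mult on13_mult on1_mult on2_mult)

lemma on12_site_commute: "on12 (on2 A) ** on12 (on1 B) = on12 (on1 B) ** on12 (on2 (A :: complex^'m^'m))"
  by (simp add: on1_on2_commute mult.commute flip: on12_mult)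

text \<open>Each site occurs in two of the three exchange matrices. Its inner \<open>G\<close>
  reaches the matching \<open>H\<close> because the exchange matrix possibly lying between them does
  not act on that site; what remains is the bare triple product between common outer
  factors.\<close>

lemma gauged_yang_baxter:
  assumes "on12 (S k1 k2) ** on13 (S k1 k3) ** on23 (S k2 k3) = on23 (S k2 k3) ** on13 (S k1 k3) ** on12 (S k1 k2)"
  shows "on12 (gauged H G S k1 k2) ** on13 (gauged H G S k1 k3) ** on23 (gauged H G S k2 k3) =
    on23 (gauged H G S k2 k3) ** on13 (gauged H G S k1 k3) ** on12 (gauged H G S k1 k2)"
proof -
  \<comment> \<open>Oriented so that every \<open>H\<close> moves to the left and every \<open>G\<close> to the right, as far as the sites allow.\<close>
  note c12 = on12_site_commute
  note c13 = on12_on3_commute[of "on1 _", symmetric]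
  note c23 = on12_on3_commute[of "on2 _", symmetric]
  note sort = c12[of "G _" "G _"] c12[of "H _" "H _"] c12[of "G _" "H _"] c12[of "H _" "G _", symmetric]
    c13[of "G _" "G _"] c13[of "H _" "H _"] c13[of "G _" "H _"] c13[of "H _" "G _", symmetric]
    c23[of "G _" "G _"] c23[of "H _" "H _"] c23[of "G _" "H _"] c23[of "H _" "G _", symmetric]
    on12_on3_commute[of "S _ _" "H _"] on12_on3_commute[of "S _ _" "G _", symmetric]
    on13_on2_commute[of "S _ _" "H _"] on13_on2_commute[of "S _ _" "G _", symmetric]
    on23_on1_commute[of "S _ _" "H _"] on23_on1_commute[of "S _ _" "G _", symmetric]
  have yb: "on12 (S k1 k2) ** (on13 (S k1 k3) ** (on23 (S k2 k3) ** X)) =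
      on23 (S k2 k3) ** (on13 (S k1 k3) ** (on12 (S k1 k2) ** X))" for X :: "complex^('m \<times> 'm \<times> 'm)^('m \<times> 'm \<times> 'm)"
    by (simp add: assms matrix_mul_assoc)
  show ?thesis
    by (simp add: gauged_def on12_mult on13_mult on23_mult on13_on1 on23_on1 on23_on2
      matrix_mul_assoc[symmetric] on12_on3_GH on12_on3_GH[THEN mult_cancel_tail]
      sort sort[THEN mult_assoc_tail] yb)
qed

end

section \<open>Congruence modulo a two-sided ideal and covariance of the defect relations\<close>

lemma two_sided_ideal_sum:
  "two_sided_ideal I \<Longrightarrow> (\<And>x. x \<in> A \<Longrightarrow> f x \<in> I) \<Longrightarrow> sum f A \<in> I"
  by (induction A rule: infinite_finite_induct) (auto simp: two_sided_ideal_def)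

lemma mat_eq_mod_mult:
  assumes "two_sided_ideal I" "mat_eq_mod I A B"
  shows "mat_eq_mod I (X ** A ** Y) (X ** B ** (Y :: 'a::ring_1^'i::finite^'m::finite))"
proof -
  have "(\<Sum>k\<in>UNIV. \<Sum>l\<in>UNIV. X $ i $ l * (A $ l $ k - B $ l $ k) * Y $ k $ j) \<in> I" for i j
    using assms by (intro two_sided_ideal_sum) (auto simp: two_sided_ideal_def mat_eq_mod_def)
  then show ?thesis
    by (simp add: mat_eq_mod_def matrix_mult_nth sum_subtractf sum_distrib_right left_diff_distrib right_diff_distrib)
qed

lemma two_sided_ideal_defect_ideal: "two_sided_ideal (defect_ideal g)"
  by (auto simp: two_sided_ideal_def defect_ideal_def)

text \<open>Each relation only demands that certain elements belong to the ideal, a condition that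
  survives intersection.\<close>

lemma defect_relations_defect_ideal: "defect_relations (defect_ideal g) (S_mat g) r_mat t_mat"
  by (auto simp: defect_relations_def defect_ideal_def mat_eq_mod_def Let_def)

lemma defect_relations_gauged:
  fixes G H :: "real \<Rightarrow> complex^(pm \<times> 'n)^(pm \<times> 'n::finite)"
  assumes I: "two_sided_ideal I" and rel: "defect_relations I S r t"
    and GH: "\<And>k. G k ** H k = mat 1"
  shows "defect_relations I (gauged H G S) (\<lambda>k. num (H k) ** r k ** num (G (- k))) (\<lambda>k. num (H k) ** t k ** num (G k))"
proof -
  have HG: "H k ** G k = mat 1" for k
    using GH by (simp add: matrix_left_right_inverse)
  have nGH: "num (G k) ** num (H k) = (mat 1 :: 'n defect_free^_^_)" for k
    by (simp add: GH num_mat flip: num_mult)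
  have nHG: "num (H k) ** num (G k) = (mat 1 :: 'n defect_free^_^_)" for k
    by (simp add: HG num_mat flip: num_mult)
  note simps = matrix_mul_assoc[symmetric] nGH nGH[THEN mult_cancel_tail]
  \<comment> \<open>The reversed momentum in the gauge of \<open>r\<close> matters here:
    \<open>G (- k)\<close> to the right of \<open>r k\<close> cancels \<open>H (- k)\<close> to the
    left of \<open>r (- k)\<close>, and both summands end in \<open>G k\<close>.\<close>
  have t2: "num (H k) ** t k ** num (G k) ** (num (H k) ** t k ** num (G k)) +
      num (H k) ** r k ** num (G (- k)) ** (num (H (- k)) ** r (- k) ** num (G (- (- k)))) =
      num (H k) ** (t k ** t k + r k ** r (- k)) ** num (G k)" for k
    by (simp add: simps matrix_add_ldistrib matrix_add_rdistrib)
  have tr: "num (H k) ** t k ** num (G k) ** (num (H k) ** r k ** num (G (- k))) +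
      num (H k) ** r k ** num (G (- k)) ** (num (H (- k)) ** t (- k) ** num (G (- k))) =
      num (H k) ** (t k ** r k + r k ** t (- k)) ** num (G (- k))" for k
    by (simp add: simps matrix_add_ldistrib matrix_add_rdistrib)
  note conj = mat_eq_mod_mult[OF I]
  have 4: "mat_eq_mod I (num (H k) ** (t k ** t k + r k ** r (- k)) ** num (G k)) (mat 1)" for k
    using conj[of "t k ** t k + r k ** r (- k)" "mat 1" "num (H k)" "num (G k)"] rel
    by (simp add: nHG defect_relations_def Let_def)
  have 5: "mat_eq_mod I (num (H k) ** (t k ** r k + r k ** t (- k)) ** num (G (- k))) 0" for k
    using conj[of "t k ** r k + r k ** t (- k)" 0 "num (H k)" "num (G (- k))"] rel
    by (simp add: defect_relations_def Let_def)
  have ex: "mat_eq_mod I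
      (num (gauged H G S k1 k2) ** on1 (num (H k1) ** X ** num (G p1)) ** num (flip12 (gauged H G S k2 p1))
         ** on2 (num (H k2) ** Y ** num (G p2)))
      (on2 (num (H k2) ** Y ** num (G p2)) ** num (gauged H G S k1 p2) ** on1 (num (H k1) ** X ** num (G p1))
         ** num (flip12 (gauged H G S p2 p1)))"
    if "mat_eq_mod I (num (S k1 k2) ** on1 X ** num (flip12 (S k2 p1)) ** on2 Y)
      (on2 Y ** num (S k1 p2) ** on1 X ** num (flip12 (S p2 p1)))" for k1 k2 p1 p2 X Y
    by (subst gauged_exchange_left[OF GH], subst gauged_exchange_right[OF GH]) (rule conj[OF that])
  show ?thesis
    unfolding defect_relations_def Let_def t2 tr
    using rel by (intro conjI allI 4 5 ex) (simp_all add: defect_relations_def Let_def)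
qed

section \<open>The square root of \<open>\<Lambda>\<close>\<close>

text \<open>For \<open>E\<^sup>2 = 1\<close>, \<open>phase_mat E u\<close> is the identity on the \<open>+1\<close> eigenspace of \<open>E\<close> and \<open>u\<close> on the \<open>-1\<close>
  eigenspace, so it is multiplicative in \<open>u\<close>.\<close>

definition phase_mat :: "complex^'n^'n \<Rightarrow> complex \<Rightarrow> complex^'n^'n" where
  "phase_mat E u = (1 / 2) *\<^sub>m ((1 + u) *\<^sub>m mat 1 + (1 - u) *\<^sub>m E)"

lemma phase_mat_mult:
  assumes "E ** E = mat 1"
  shows "phase_mat E u ** phase_mat E v = phase_mat E (u * v)"
  unfolding phase_mat_def
  by (simp add: matrix_add_ldistrib matrix_add_rdistrib smult_mult_left smult_mult_right assms)
    (simp add: vec_eq_iff smult_mat_nth, simp add: algebra_simps)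

lemma phase_mat_1: "phase_mat E 1 = mat 1"
  by (simp add: phase_mat_def vec_eq_iff smult_mat_nth)

text \<open>At x = a k this is the eigenvalue of \<open>lambda_real\<close> on the -1 eigenspace of
  \<open>E\<close>: a unimodular square root of (1 - i x) / (1 + i x), equal to 1 at x = 0, whose
  conjugate is its value at -x.\<close>

definition phase :: "real \<Rightarrow> complex" where
  "phase x = (1 - \<i> * of_real x) / of_real (sqrt (1 + x\<^sup>2))"

lemma phase_square: "(phase x)\<^sup>2 = (1 - \<i> * of_real x) / (1 + \<i> * of_real x)"
proof -
  define z where "z = \<i> * complex_of_real x"
  have "1 - z \<noteq> 0"
    by (simp add: z_def complex_eq_iff)
  moreover have "(of_real (sqrt (1 + x\<^sup>2)))\<^sup>2 = (1 + z) * (1 - z)"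
    by (simp add: z_def algebra_simps power2_eq_square flip: of_real_power of_real_mult)
  then have "(phase x)\<^sup>2 = ((1 - z) * (1 - z)) / ((1 + z) * (1 - z))"
    by (simp add: phase_def power_divide power2_eq_square[of "1 - z"] flip: z_def)
  ultimately show ?thesis
    by (simp flip: z_def)
qed

lemma phase_minus: "phase x * phase (- x) = 1"
proof -
  define z where "z = \<i> * complex_of_real x"
  define w where "w = complex_of_real (sqrt (1 + x\<^sup>2))"
  have "w * w = (1 - z) * (1 + z)"
    by (simp add: w_def z_def algebra_simps power2_eq_square flip: of_real_mult)
  moreover have "w \<noteq> 0"
    by (simp add: w_def add_nonneg_eq_0_iff)
  moreover have "phase x * phase (- x) = ((1 - z) * (1 + z)) / (w * w)"
    by (simp add: phase_def z_def w_def)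
  ultimately show ?thesis
    by (metis divide_self mult_eq_0_iff)
qed

lemma lambda_real_eq: "lambda_real E k a = phase_mat E (phase (a * k))"
  by (simp add: lambda_real_def phase_mat_def phase_def Let_def)

lemma Lambda_real_eq: "Lambda_real E k a = phase_mat E ((phase (a * k))\<^sup>2)"
proof -
  define z where "z = \<i> * complex_of_real (a * k)"
  have "1 + z \<noteq> 0"
    by (simp add: z_def complex_eq_iff)
  then have "1 + (1 - z) / (1 + z) = 2 / (1 + z)" "1 - (1 - z) / (1 + z) = 2 * z / (1 + z)"
    by (simp_all add: divide_simps)
  then show ?thesis
    unfolding phase_square Lambda_real_def phase_mat_def z_def[symmetric]
    by (simp add: vec_eq_iff smult_mat_nth distrib_left)
qed

lemma phase_at_top: "(phase \<longlongrightarrow> - \<i>) at_top"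
proof -
  have "((\<lambda>x. Complex (1 / sqrt (1 + x\<^sup>2)) (- x / sqrt (1 + x\<^sup>2))) \<longlongrightarrow> Complex 0 (-1)) at_top"
    by (intro tendsto_Complex; real_asymp)
  moreover have "(\<lambda>x. Complex (1 / sqrt (1 + x\<^sup>2)) (- x / sqrt (1 + x\<^sup>2))) = phase"
    by (simp add: phase_def complex_eq_iff fun_eq_iff Re_divide_of_real Im_divide_of_real)
  moreover have "Complex 0 (-1) = - \<i>"
    by (simp add: complex_eq_iff)
  ultimately show ?thesis
    by simp
qed

lemma phase_at_bot: "(phase \<longlongrightarrow> \<i>) at_bot"
proof -
  have "((\<lambda>x. cnj (phase x)) \<longlongrightarrow> cnj (- \<i>)) at_top"
    by (intro tendsto_intros phase_at_top)
  moreover have "cnj (phase x) = phase (- x)" for x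
    by (simp add: phase_def)
  ultimately show ?thesis
    by (simp add: filterlim_at_bot_mirror)
qed

text \<open>For \<open>at_top\<close> the limit u(k) is -i, 1 or i as k is positive, zero or
  negative, and for \<open>at_bot\<close> the signs are reversed. The inverse relation holds before
  the limit by \<open>phase_minus\<close> and passes to it by continuity of the product.\<close>

lemma tendsto_phase_mult:
  assumes "F = at_top \<or> F = at_bot"
  obtains u where "\<And>k. ((\<lambda>a. phase (a * k)) \<longlongrightarrow> u k) F" and "\<And>k. u k * u (- k) = 1"
proof -
  have "\<exists>l. ((\<lambda>a. phase (a * k)) \<longlongrightarrow> l) F" for k
  proof (cases k "0 :: real" rule: linorder_cases)
    case less
    then have "filterlim (\<lambda>a. a * k) at_bot at_top" "filterlim (\<lambda>a. a * k) at_top at_bot"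
      by real_asymp+
    then show ?thesis
      using assms filterlim_compose[OF phase_at_top] filterlim_compose[OF phase_at_bot] by blast
  next
    case equal
    then show ?thesis
      by auto
  next
    case greater
    then have "filterlim (\<lambda>a. a * k) at_bot at_bot" "filterlim (\<lambda>a. a * k) at_top at_top"
      by real_asymp+
    then show ?thesis
      using assms filterlim_compose[OF phase_at_top] filterlim_compose[OF phase_at_bot] by blast
  qed
  then obtain u where u: "\<And>k. ((\<lambda>a. phase (a * k)) \<longlongrightarrow> u k) F"
    by metis
  have "u k * u (- k) = 1" for k
  proof (rule tendsto_unique)
    show "F \<noteq> bot"
      using assms trivial_limit_at_top_linorder trivial_limit_at_bot_linorder by metis
    show "((\<lambda>a. phase (a * k) * phase (a * - k)) \<longlongrightarrow> u k * u (- k)) F"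
      by (intro tendsto_mult u)
    show "((\<lambda>a. phase (a * k) * phase (a * - k)) \<longlongrightarrow> 1) F"
      using phase_minus by simp
  qed
  with u show thesis
    using that by blast
qed

lemma tendsto_phase_mat: "(u \<longlongrightarrow> l) F \<Longrightarrow> ((\<lambda>a. phase_mat E (u a)) \<longlongrightarrow> phase_mat E l) F"
  unfolding phase_mat_def smult_mat_def plus_vec_def
  by (intro tendsto_intros vec_tendstoI) simp

lemma lambda_mat_eq_phase_mat:
  fixes E :: "complex^'n^'n"
  obtains u where "\<And>k. lambda_mat a E k = phase_mat E (u k)" and "\<And>k. Lambda_mat a E k = phase_mat E ((u k)\<^sup>2)"
    and "\<And>k. u k * u (- k) = 1"
proof -
  note result = that
  have lim: thesis
    if F: "F = at_top \<or> F = at_bot" and a: "\<And>f :: real \<Rightarrow> complex^'n^'n. at_ext f a = Lim F f" for F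
  proof -
    have F_nontrivial: "F \<noteq> bot"
      using F trivial_limit_at_top_linorder trivial_limit_at_bot_linorder by metis
    obtain u where u: "\<And>k. ((\<lambda>a. phase (a * k)) \<longlongrightarrow> u k) F" and uu: "\<And>k. u k * u (- k) = 1"
      using tendsto_phase_mult[OF F] by blast
    have "lambda_mat a E k = phase_mat E (u k)" for k
      unfolding lambda_mat_def a lambda_real_eq
      by (intro tendsto_Lim tendsto_phase_mat u F_nontrivial)
    moreover have "Lambda_mat a E k = phase_mat E ((u k)\<^sup>2)" for k
      unfolding Lambda_mat_def a Lambda_real_eq
      by (intro tendsto_Lim tendsto_phase_mat tendsto_power u F_nontrivial)
    ultimately show thesis
      using uu by (rule result)
  qed
  show thesis
  proof (cases a)
    case (real r)
    then show thesis
      using result[of "\<lambda>k. phase (r * k)"] phase_minus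
      by (simp add: lambda_mat_def Lambda_mat_def lambda_real_eq Lambda_real_eq)
  next
    case PInf
    have "at_ext f a = Lim at_top f" for f :: "real \<Rightarrow> complex^'n^'n"
      unfolding PInf infinity_ereal_def by (rule at_ext.simps)
    then show thesis
      by (rule lim[rotated]) simp
  next
    case MInf
    have "at_ext f a = Lim at_bot f" for f :: "real \<Rightarrow> complex^'n^'n"
      unfolding MInf infinity_ereal_def uminus_ereal.simps by (rule at_ext.simps)
    then show thesis
      by (rule lim[rotated]) simp
  qed
qed

lemma lambda_mat_facts:
  assumes "E ** E = mat 1"
  shows lambda_mat_square: "lambda_mat a E k ** lambda_mat a E k = Lambda_mat a E k"
    and lambda_mat_inverse: "lambda_mat a E k ** lambda_mat a E (- k) = mat 1"
    and lambda_mat_sandwich: "lambda_mat a E (- k) ** Lambda_mat a E k ** lambda_mat a E (- k) = mat 1"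
proof -
  obtain u where u: "\<And>k. lambda_mat a E k = phase_mat E (u k)" "\<And>k. Lambda_mat a E k = phase_mat E ((u k)\<^sup>2)"
    "\<And>k. u k * u (- k) = 1"
    using lambda_mat_eq_phase_mat[of a E] by metis
  have "u (- k) * (u k)\<^sup>2 * u (- k) = (u k * u (- k)) * (u k * u (- k))"
    by (simp add: power2_eq_square mult_ac)
  then show "lambda_mat a E (- k) ** Lambda_mat a E k ** lambda_mat a E (- k) = mat 1"
    by (simp add: u phase_mat_mult[OF assms] phase_mat_1)
  show "lambda_mat a E k ** lambda_mat a E k = Lambda_mat a E k"
    by (simp add: u phase_mat_mult[OF assms] power2_eq_square)
  show "lambda_mat a E k ** lambda_mat a E (- k) = mat 1"
    by (simp add: u phase_mat_mult[OF assms] phase_mat_1)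
qed

section \<open>The gauge transformation given by \<open>\<lambda>\<close> and \<open>M\<close>\<close>

lemma S_mat_unitary:
  assumes "g \<noteq> 0"
  shows "S_mat g k1 k2 ** flip12 (S_mat g k2 k1) =
    (mat 1 :: complex^((pm \<times> 'n::finite) \<times> (pm \<times> 'n))^((pm \<times> 'n) \<times> (pm \<times> 'n)))"
proof -
  have "s_mat g (k - l) ** s_mat g (l - k) = (mat 1 :: complex^('n \<times> 'n)^('n \<times> 'n))" for k l
    using s_mat_unitary[OF assms, of "k - l"] by simp
  then show ?thesis
    by (simp add: S_mat_def flip12_diag_blocks2 flip12_s_mat diag_blocks2_mult diag_blocks2_mat)
qed

lemma S_mat_yang_baxter:
  fixes g k1 k2 k3 :: real
  defines "S \<equiv> S_mat g :: real \<Rightarrow> real \<Rightarrow> complex^((pm \<times> 'n::finite) \<times> (pm \<times> 'n))^((pm \<times> 'n) \<times> (pm \<times> 'n))"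
  shows "on12 (S k1 k2) ** on13 (S k1 k3) ** on23 (S k2 k3) = on23 (S k2 k3) ** on13 (S k1 k3) ** on12 (S k1 k2)"
proof -
  let ?s = "\<lambda>k. s_mat g k :: complex^('n \<times> 'n)^('n \<times> 'n)"
  have "on12 (?s (x - y)) ** on13 (?s (x - z)) ** on23 (?s (y - z)) =
     on23 (?s (y - z)) ** on13 (?s (x - z)) ** on12 (?s (x - y))" for x y z
    using s_mat_yang_baxter[of g "x - y" "y - z"] by simp
  then show ?thesis
    by (simp add: S_def S_mat_def on12_diag_blocks2 on13_diag_blocks2 on23_diag_blocks2 diag_blocks3_mult)
qed

lemma matrix_inv_inverse:
  assumes "invertible M"
  shows matrix_inv_right: "M ** matrix_inv M = mat 1" and matrix_inv_left: "matrix_inv M ** M = mat 1"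
  using someI_ex[OF assms[unfolded invertible_def]] by (simp_all add: matrix_inv_def)

definition gauge_mat :: "ereal \<Rightarrow> complex^'n^'n \<Rightarrow> complex^'n^'n \<Rightarrow> real \<Rightarrow> complex^(pm \<times> 'n)^(pm \<times> 'n::finite)" where
  "gauge_mat a E M k = diag_blocks (\<lambda>x. M ** lambda_mat a E (pm_val x * k))"

definition gauge_mat_inv :: "ereal \<Rightarrow> complex^'n^'n \<Rightarrow> complex^'n^'n \<Rightarrow> real \<Rightarrow> complex^(pm \<times> 'n)^(pm \<times> 'n::finite)" where
  "gauge_mat_inv a E M k = diag_blocks (\<lambda>x. lambda_mat a E (- (pm_val x * k)) ** matrix_inv M)"

lemma gauge_inverse:
  assumes "E ** E = mat 1" "invertible M"
  shows "gauge_mat a E M k ** gauge_mat_inv a E M k = mat 1"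
proof -
  have "M ** lambda_mat a E l ** (lambda_mat a E (- l) ** matrix_inv M) = mat 1" for l
    by (simp add: mult_cancel_tail[OF lambda_mat_inverse[OF assms(1)]] matrix_inv_right[OF assms(2)]
        flip: matrix_mul_assoc)
  then show ?thesis
    by (simp add: gauge_mat_def gauge_mat_inv_def diag_blocks_mult diag_blocks_mat)
qed

lemma pm_val_opp: "pm_val (pm_opp x) = - pm_val x"
  by (cases x) auto

text \<open>The dressing has \<lambda>(-xk) on the right for row sign x. Since \<open>r_mat\<close>
  preserves the sign, that is the block of the gauge matrix at -k; \<open>t_mat\<close> reverses the
  sign, so in \<open>t_tilde_eq\<close> the same factor is the block of opposite sign at k.\<close>

lemma r_tilde_eq: "r_tilde a E M k = num (gauge_mat_inv a E M k) ** r_mat k ** num (gauge_mat a E M (- k))"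
  by (simp add: r_tilde_def r_tilde_gen_def dressed_def gauge_mat_def gauge_mat_inv_def r_mat_def num_diag_blocks
      diag_blocks_mult num_mult matrix_mul_assoc)

lemma t_tilde_eq: "t_tilde a E M k = num (gauge_mat_inv a E M k) ** t_mat k ** num (gauge_mat a E M k)"
  by (simp add: t_tilde_def t_tilde_gen_def dressed_def gauge_mat_def gauge_mat_inv_def t_mat_def num_diag_blocks
      diag_blocks_mult_offdiag offdiag_blocks_mult_diag num_mult matrix_mul_assoc pm_val_opp)

lemma S_tilde_eq:
  assumes "invertible M"
  shows "S_tilde g a E k1 k2 = gauged (gauge_mat_inv a E M) (gauge_mat a E M) (S_mat g) k1 k2"
proof -
  have MM: "matrix_inv M ** M = mat 1"
    by (rule matrix_inv_left[OF assms])
  have c: "on2 A ** on1 B = on1 B ** on2 A" for A B :: "complex^'n^'n"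
    by (rule on1_on2_commute[symmetric]) (rule mult.commute)
  have s: "on1 (matrix_inv M) ** on2 (matrix_inv M) ** s_mat g k ** (on1 M ** on2 M) = s_mat g k" for k
  proof -
    have "on1 (matrix_inv M) ** on2 (matrix_inv M) ** (on1 M ** on2 M) =
      on1 (matrix_inv M ** M) ** on2 (matrix_inv M ** M)"
      by (simp add: on1_mult on2_mult c[THEN mult_assoc_tail] flip: matrix_mul_assoc)
    also have "\<dots> = mat 1"
      by (simp add: MM on1_mat on2_mat)
    finally show ?thesis
      by (simp add: s_mat_on1_on2 flip: matrix_mul_assoc) (simp add: matrix_mul_assoc)
  qed
  have "s_tilde g a E k l = on1 (lambda_mat a E (- k) ** matrix_inv M) ** on2 (lambda_mat a E (- l) ** matrix_inv M)
      ** s_mat g (k - l) ** on1 (M ** lambda_mat a E k) ** on2 (M ** lambda_mat a E l)" (is "_ = ?r") for k l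
  proof -
    have "?r = on1 (lambda_mat a E (- k)) ** on2 (lambda_mat a E (- l)) **
      (on1 (matrix_inv M) ** on2 (matrix_inv M) ** s_mat g (k - l) ** (on1 M ** on2 M)) **
      (on1 (lambda_mat a E k) ** on2 (lambda_mat a E l))"
      by (simp add: on1_mult on2_mult c[of _ M] c[of _ M, THEN mult_assoc_tail] c[of M] c[of M, THEN mult_assoc_tail]
          c[of _ "matrix_inv M"] c[of _ "matrix_inv M", THEN mult_assoc_tail] flip: matrix_mul_assoc)
    then show ?thesis
      unfolding s by (simp add: s_tilde_def matrix_mul_assoc)
  qed
  then show ?thesis
    by (simp add: S_tilde_def gauged_def gauge_mat_def gauge_mat_inv_def S_mat_def on1_diag_blocks on2_diag_blocks diag_blocks2_mult)
qed

lemma unitary_mat_invertible: "unitary_mat M \<Longrightarrow> invertible M"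
  unfolding unitary_mat_def invertible_def by blast

section \<open>Vacuum expectation values\<close>

context fock_representation
begin

definition vev :: "'n defect_free \<Rightarrow> complex" where
  "vev x = op_vev ip \<Omega> (\<pi> x)"

lemma mat_vev_nth: "mat_vev ip \<pi> \<Omega> X $ i $ j = vev (X $ i $ j)"
  by (simp add: mat_vev_def vev_def)

lemma vev_add: "vev (x + y) = vev x + vev y"
  by (simp add: vev_def op_vev_def rep_add ip_add)

lemma vev_0: "vev 0 = 0"
  using vev_add[of 0 0] by simp

lemma vev_sum: "vev (sum f A) = (\<Sum>x\<in>A. vev (f x))"
  by (induction A rule: infinite_finite_induct) (simp_all add: vev_0 vev_add)

lemma vev_scalar_left: "vev (scalar c * x) = c * vev x"
  by (simp add: vev_def op_vev_def rep_mult rep_scalar ip_scale)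

lemma vev_scalar_right: "vev (x * scalar c) = vev x * c"
  by (simp add: vev_scalar_left mult.commute flip: scalar_commute)

text \<open>Dressing is linear in the generators, so its effect on expectation values follows from
  linearity of \<open>vev\<close>; numbers on the right come out as well because they are
  central.\<close>

lemma mat_vev_num_mult_left: "mat_vev ip \<pi> \<Omega> (num A ** X) = A ** mat_vev ip \<pi> \<Omega> X"
  by (simp add: vec_eq_iff mat_vev_nth matrix_mult_nth num_nth vev_sum vev_scalar_left)

lemma mat_vev_num_mult_right: "mat_vev ip \<pi> \<Omega> (X ** num A) = mat_vev ip \<pi> \<Omega> X ** A"
  by (simp add: vec_eq_iff mat_vev_nth matrix_mult_nth num_nth vev_sum vev_scalar_right)

lemma vev_trace: "vev (trace X) = trace (mat_vev ip \<pi> \<Omega> X)"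
  by (simp add: trace_def vev_sum mat_vev_nth)

lemma mat_vev_dressed:
  assumes E: "E ** E = mat 1" and M: "invertible M"
    and X: "mat_vev ip \<pi> \<Omega> X = c *\<^sub>m (M ** Lambda_mat a E (pm_val x * k) ** matrix_inv M)"
  shows "mat_vev ip \<pi> \<Omega> (dressed a E M x k X) = c *\<^sub>m mat 1"
proof -
  let ?l = "lambda_mat a E (- (pm_val x * k))"
  have MM: "matrix_inv M ** M = mat 1"
    by (rule matrix_inv_left[OF M])
  have "mat_vev ip \<pi> \<Omega> (dressed a E M x k X) = c *\<^sub>m (?l ** Lambda_mat a E (pm_val x * k) ** ?l)"
    unfolding dressed_def mat_vev_num_mult_right
    by (simp add: mat_vev_num_mult_left X smult_mult_left smult_mult_right MM mult_cancel_tail[OF MM]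
        flip: matrix_mul_assoc)
  then show ?thesis
    by (simp add: lambda_mat_sandwich[OF E])
qed

end

text \<open>Uniqueness of the expansion of the zero function: once all earlier coefficients vanish,
  the truncation at order n is the single term c_n k^(-n), which can be o(k^(-n)) only if c_n =
  0.\<close>

lemma asymptotic_coeffs_eq_0:
  fixes c :: "nat \<Rightarrow> complex"
  assumes F: "F = at_top \<or> F = at_bot"
    and small: "\<And>m. (\<lambda>k. \<Sum>n\<le>m. c n / of_real k ^ n) \<in> o[F](\<lambda>k :: real. 1 / of_real k ^ m)"
  shows "c n = 0"
proof (induction n rule: less_induct)
  case (less n)
  have "(\<Sum>j\<le>n. c j / complex_of_real k ^ j) = c n * (1 / of_real k ^ n)" for k
  proof -
    have "(\<Sum>j\<le>n. c j / complex_of_real k ^ j) = (\<Sum>j\<in>{n}. c j / of_real k ^ j)"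
      using less by (intro sum.mono_neutral_right) auto
    then show ?thesis
      by simp
  qed
  then have *: "(\<lambda>k. c n * (1 / complex_of_real k ^ n)) \<in> o[F](\<lambda>k. 1 / of_real k ^ n)"
    using small[of n] by simp
  have "eventually (\<lambda>k. k \<noteq> 0) F"
    using F eventually_gt_at_top[of "0 :: real"] eventually_gt_at_bot[of "0 :: real"]
    by (auto elim: eventually_mono)
  then have nz: "eventually (\<lambda>k. 1 / complex_of_real k ^ n \<noteq> 0) F"
    by eventually_elim simp
  show "c n = 0"
  proof (rule ccontr)
    assume "c n \<noteq> 0"
    then have "(\<lambda>k. 1 / complex_of_real k ^ n) \<in> o[F](\<lambda>k. 1 / of_real k ^ n)"
      using * by (simp only: landau_o.small.cmult_in_iff not_False_eq_True)
    then have "eventually (\<lambda>k. 1 / complex_of_real k ^ n = 0) F"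
      by (simp only: landau_o.small_refl_iff)
    with nz have "eventually (\<lambda>k. False) F"
      by eventually_elim simp
    then show False
      using F trivial_limit_at_top_linorder trivial_limit_at_bot_linorder
      by (metis eventually_False)
  qed
qed

text \<open>The expansion is a statement about all matrix elements; taken between \<Omega> and
  \<Omega> it expands the zero function, and its coefficients are the expectation values of the
  generators.\<close>

lemma generator_from_unbroken:
  assumes "generator_from ip \<pi> X G" and "\<And>k. op_vev ip \<Omega> (\<pi> (X k)) = 0"
  shows "unbroken ip \<Omega> G"
proof -
  obtain F A n where F: "F = at_top \<or> F = at_bot" and "k_inv_expansion ip \<pi> F X A" and G: "G = A n"
    using assms(1) by (auto simp: generator_from_def)
  then have "(\<lambda>k. ip \<Omega> (\<pi> (X k) \<Omega>) - (\<Sum>n\<le>m. ip \<Omega> (A n \<Omega>) / complex_of_real k ^ n))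
      \<in> o[F](\<lambda>k. 1 / complex_of_real k ^ m)" for m
    by (simp add: k_inv_expansion_def)
  then have "(\<lambda>k. \<Sum>n\<le>m. ip \<Omega> (A n \<Omega>) / complex_of_real k ^ n) \<in> o[F](\<lambda>k. 1 / complex_of_real k ^ m)" for m
    using assms(2) by (simp add: op_vev_def)
  then have "ip \<Omega> (A n \<Omega>) = 0"
    using F by (intro asymptotic_coeffs_eq_0[where c = "\<lambda>n. ip \<Omega> (A n \<Omega>)"])
  then show ?thesis
    by (simp add: unbroken_def op_vev_def G)
qed

theorem mainTheorem5:
  fixes g :: real
    and a :: ereal
    and E M :: "complex^'n^'n"
    and \<rho> \<tau> :: "pm \<Rightarrow> real \<Rightarrow> complex"
    and scale :: "complex \<Rightarrow> 'v::ab_group_add \<Rightarrow> 'v"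
    and ip :: "'v \<Rightarrow> 'v \<Rightarrow> complex"
    and \<pi> :: "'n defect_free \<Rightarrow> 'v \<Rightarrow> 'v"
    and \<Omega> :: 'v
  assumes g_nonzero: "g \<noteq> 0"
    and M_unitary: "unitary_mat M"
    and E_diag: "\<And>i j. i \<noteq> j \<Longrightarrow> E $ i $ j = 0"
    and E_square: "E ** E = mat 1"
    and fock: "fock_representation scale ip g \<pi> \<Omega>"
    and vev_r: "\<And>x k. mat_vev ip \<pi> \<Omega> (r_gen x k) =
                  \<rho> x k *\<^sub>m (M ** Lambda_mat a E (pm_val x * k) ** matrix_inv M)"
    and vev_t: "\<And>x k. mat_vev ip \<pi> \<Omega> (t_gen x k) =
                  \<tau> x k *\<^sub>m (M ** Lambda_mat a E (pm_val x * k) ** matrix_inv M)"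
  shows
    "(\<forall>k. lambda_mat a E k ** lambda_mat a E k = Lambda_mat a E k \<and>
          lambda_mat a E k ** lambda_mat a E (- k) = mat 1) \<and>
     (\<forall>k1 k2. S_tilde g a E k1 k2 ** flip12 (S_tilde g a E k2 k1) = mat 1) \<and>
     (\<forall>k1 k2 k3.
        on12 (S_tilde g a E k1 k2) ** on13 (S_tilde g a E k1 k3) ** on23 (S_tilde g a E k2 k3) =
        on23 (S_tilde g a E k2 k3) ** on13 (S_tilde g a E k1 k3) ** on12 (S_tilde g a E k1 k2)) \<and>
     defect_relations (defect_ideal g) (S_tilde g a E) (r_tilde a E M) (t_tilde a E M) \<and>
     (\<forall>x k. mat_vev ip \<pi> \<Omega> (r_tilde_gen a E M x k) = \<rho> x k *\<^sub>m mat 1 \<and>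
            mat_vev ip \<pi> \<Omega> (t_tilde_gen a E M x k) = \<tau> x k *\<^sub>m mat 1) \<and>
     (\<forall>x i j. i \<noteq> j \<longrightarrow>
        (\<forall>k. op_vev ip \<Omega> (\<pi> (r_tilde_gen a E M x k $ i $ j)) = 0 \<and>
             op_vev ip \<Omega> (\<pi> (t_tilde_gen a E M x k $ i $ j)) = 0) \<and>
        (\<forall>G. generator_from ip \<pi> (\<lambda>k. r_tilde_gen a E M x k $ i $ j) G \<longrightarrow> unbroken ip \<Omega> G) \<and>
        (\<forall>G. generator_from ip \<pi> (\<lambda>k. t_tilde_gen a E M x k $ i $ j) G \<longrightarrow> unbroken ip \<Omega> G)) \<and>
     (\<forall>x C. trace C = 0 \<longrightarrow>
        (\<forall>G. generator_from ip \<pi> (\<lambda>k. trace (num C ** r_tilde_gen a E M x k)) G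
               \<longrightarrow> unbroken ip \<Omega> G) \<and>
        (\<forall>G. generator_from ip \<pi> (\<lambda>k. trace (num C ** t_tilde_gen a E M x k)) G
               \<longrightarrow> unbroken ip \<Omega> G))"
proof -
  interpret fock_representation scale ip g \<pi> \<Omega>
    by (rule fock)
  have M: "invertible M"
    by (rule unitary_mat_invertible[OF M_unitary])
  note GH = gauge_inverse[OF E_square M, of a]
  note S = S_tilde_eq[OF M, of g a E]
  have relations: "defect_relations (defect_ideal g) (S_tilde g a E) (r_tilde a E M) (t_tilde a E M)"
  proof -
    have "S_tilde g a E = gauged (gauge_mat_inv a E M) (gauge_mat a E M) (S_mat g)"
      "r_tilde a E M = (\<lambda>k. num (gauge_mat_inv a E M k) ** r_mat k ** num (gauge_mat a E M (- k)))"
      "t_tilde a E M = (\<lambda>k. num (gauge_mat_inv a E M k) ** t_mat k ** num (gauge_mat a E M k))"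
      by (intro ext S r_tilde_eq t_tilde_eq)+
    then show ?thesis
      using defect_relations_gauged[OF two_sided_ideal_defect_ideal defect_relations_defect_ideal GH] by simp
  qed
  have r: "mat_vev ip \<pi> \<Omega> (r_tilde_gen a E M x k) = \<rho> x k *\<^sub>m mat 1" for x k
    unfolding r_tilde_gen_def by (rule mat_vev_dressed[OF E_square M vev_r])
  have t: "mat_vev ip \<pi> \<Omega> (t_tilde_gen a E M x k) = \<tau> x k *\<^sub>m mat 1" for x k
    unfolding t_tilde_gen_def by (rule mat_vev_dressed[OF E_square M vev_t])
  have offdiag: "op_vev ip \<Omega> (\<pi> (r_tilde_gen a E M x k $ i $ j)) = 0"
    "op_vev ip \<Omega> (\<pi> (t_tilde_gen a E M x k $ i $ j)) = 0" if "i \<noteq> j" for x k i j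
    using r[of x k] t[of x k] that by (simp_all add: vec_eq_iff mat_vev_def smult_mat_nth mat_nth)
  have traces: "op_vev ip \<Omega> (\<pi> (trace (num C ** r_tilde_gen a E M x k))) = 0"
    "op_vev ip \<Omega> (\<pi> (trace (num C ** t_tilde_gen a E M x k))) = 0" if "trace C = 0" for x k C
  proof -
    \<comment> \<open>The dressed expectation values are scalar matrices, so pairing them with
      \<open>C\<close> yields a multiple of the trace of \<open>C\<close>.\<close>
    have "trace (C ** (c *\<^sub>m mat 1)) = 0" for c
      using that by (simp add: smult_mult_right) (simp add: trace_def smult_mat_nth flip: sum_distrib_left)
    then show "op_vev ip \<Omega> (\<pi> (trace (num C ** r_tilde_gen a E M x k))) = 0"
      "op_vev ip \<Omega> (\<pi> (trace (num C ** t_tilde_gen a E M x k))) = 0"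
      by (simp_all add: vev_trace mat_vev_num_mult_left r t flip: vev_def)
  qed
  have unitary: "S_tilde g a E k1 k2 ** flip12 (S_tilde g a E k2 k1) = mat 1" for k1 k2
    unfolding S by (intro gauged_unitary GH S_mat_unitary g_nonzero)
  have yang_baxter: "on12 (S_tilde g a E k1 k2) ** on13 (S_tilde g a E k1 k3) ** on23 (S_tilde g a E k2 k3) =
      on23 (S_tilde g a E k2 k3) ** on13 (S_tilde g a E k1 k3) ** on12 (S_tilde g a E k1 k2)" for k1 k2 k3
    unfolding S by (intro gauged_yang_baxter GH S_mat_yang_baxter)
  show ?thesis
    by (intro conjI allI impI lambda_mat_square lambda_mat_inverse E_square unitary yang_baxter relations r t offdiag)
      (assumption | erule generator_from_unbroken, rule offdiag traces, assumption)+
qed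

end
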